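(* Let $P_0\in\mathbb{C}[z]$ have degree $d\ge1$ and let $S$ be the simply connected log-Riemann surface with uniformization $F_0(z)=\int_0^ze^{P_0(t)}dt$, with completion $S^*$ and structural ring $\mathcal{A}_S$. For $w_0\in S^*$ put $\mathfrak{M}_{w_0}=\{f\in\mathcal{A}_S: f(w_0)=0\}$. Then each $\mathfrak{M}_{w_0}$ is a maximal ideal of $\mathcal{A}_S$, and $w_0\mapsto\mathfrak{M}_{w_0}$ is an injection of $S^*$ into the set of maximal ideals of $\mathcal{A}_S$. More precisely, the ring $\mathcal{A}_S$ separates the points of $S^*$.
   Context: Let $P_0(z)=a_dz^d+\dots+a_0$, $a_d\ne0$, and $F_j(z)=\int_0^zt^je^{P_0(t)}dt$ for $0\le j\le d-1$. $S$ is the Riemann surface endowed with a biholomorphism $k_0:S\to\mathbb{C}$ (inverse of the uniformization) and with projection $\pi=F_0\circ k_0:S\to\mathbb{C}$, a local biholomorphism; $S^*$ is the completion of $S$ for the path metric of the pull-back by $\pi$ of the Euclidean metric. $S^*-S$ consists of exactly $d$ points $w_1^*,\dots,w_d^*$, the infinite ramification points, one for each of the $d$ unit complex numbers $\omega_k$ with $a_d\omega_k^d<0$: $w_k^*$ is the limit in $S^*$ of $k_0^{-1}(t\omega_k)$ as $t\to+\infty$. $\mathbb{V}_{P_0}=z\mathbb{C}[z]e^{P_0}\oplus\mathbb{C}\oplus\mathbb{C}F_0\oplus\dots\oplus\mathbb{C}F_{d-1}$, and $\mathbb{A}_{P_0}$ is the ring of entire functions generated by $\mathbb{V}_{P_0}$;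 its elements are the functions $z\,A(z,F_0,\dots,F_{d-1})\,e^{P_0}+B(F_0,\dots,F_{d-1})$ with $A,B$ polynomials. The structural ring is $\mathcal{A}_S=\{F\circ k_0:F\in\mathbb{A}_{P_0}\}$. For $f=F\circ k_0\in\mathcal{A}_S$, the value $f(w_k^* )$ is its limit at $w_k^*$ along Stolz angles, i.e. $f(w_k^* )=\lim_{t\to+\infty}F(t\omega_k)$. *)

theory Defs
  imports
    "HOL-Complex_Analysis.Contour_Integration"
    "HOL-Computational_Algebra.Polynomial"
    "HOL-Algebra.Ideal"
    "HOL-Algebra.Generated_Rings"
begin

definition F_prim :: "complex poly \<Rightarrow> nat \<Rightarrow> complex \<Rightarrow> complex" where
  "F_prim P j z = contour_integral (linepath 0 z) (\<lambda>t. t ^ j * exp (poly P t))"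

definition entire_ring :: "(complex \<Rightarrow> complex) ring" where
  "entire_ring =
    \<lparr>carrier = {f. f holomorphic_on UNIV},
     monoid.mult = (\<lambda>f g z. f z * g z), one = (\<lambda>z. 1),
     zero = (\<lambda>z. 0), add = (\<lambda>f g z. f z + g z)\<rparr>"

definition V_space :: "complex poly \<Rightarrow> (complex \<Rightarrow> complex) set" where
  "V_space P =
    {\<lambda>z. z * poly q z * exp (poly P z) + c + (\<Sum>j<degree P. b j * F_prim P j z) | q c b. True}"

definition A_ring :: "complex poly \<Rightarrow> (complex \<Rightarrow> complex) set" where
  "A_ring P = generate_ring entire_ring (V_space P)"

text \<open>
  The surface \<open>S\<close> is a set together with a bijection \<open>k0\<close> onto the complex plane, and its complex
  structure is the one that makes \<open>k0\<close> biholomorphic. Functions on \<open>S\<close> are extensional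
  (\<^const>\<open>undefined\<close> off \<open>S\<close>), so that equality of functions is equality on \<open>S\<close>.
\<close>

definition structural_ring ::
    "complex poly \<Rightarrow> ('s \<Rightarrow> complex) \<Rightarrow> 's set \<Rightarrow> ('s \<Rightarrow> complex) ring" where
  "structural_ring P k0 S =
    \<lparr>carrier = {restrict (G \<circ> k0) S | G. G \<in> A_ring P},
     monoid.mult = (\<lambda>f g. \<lambda>x\<in>S. f x * g x), one = (\<lambda>x\<in>S. 1),
     zero = (\<lambda>x\<in>S. 0), add = (\<lambda>f g. \<lambda>x\<in>S. f x + g x)\<rparr>"

text \<open>
  The path distance of the pull-back of the Euclidean metric by \<open>\<pi> = F_prim P 0 \<circ> k0\<close>, read in the global
  chart \<open>k0\<close>: the length of a path is the Euclidean length of its image under \<open>F_prim P 0\<close>. The predicate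
  \<^const>\<open>has_integral\<close> excludes the piecewise \<open>C\<^sup>1\<close> paths of infinite length, to which the total
  function \<^const>\<open>integral\<close> would assign the value 0 (the derivative of a \<^const>\<open>valid_path\<close>
  may be unbounded near the finitely many exceptional parameters).
\<close>

definition path_dist :: "complex poly \<Rightarrow> complex \<Rightarrow> complex \<Rightarrow> real" where
  "path_dist P z w =
    Inf {L. \<exists>\<gamma>. valid_path \<gamma> \<and> pathstart \<gamma> = z \<and> pathfinish \<gamma> = w \<and>
              ((\<lambda>t. norm (vector_derivative (F_prim P 0 \<circ> \<gamma>) (at t))) has_integral L) {0..1}}"

text \<open>
  \<open>Sstar\<close> is a completion of \<open>S\<close> for the path distance; this determines it up to a unique isometry
  over \<open>S\<close>. The ambient metric space only serves to carry the metric of \<open>Sstar\<close>.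
\<close>

definition completed_log_surface ::
    "complex poly \<Rightarrow> ('s::metric_space \<Rightarrow> complex) \<Rightarrow> 's set \<Rightarrow> 's set \<Rightarrow> bool" where
  "completed_log_surface P k0 S Sstar \<longleftrightarrow>
     bij_betw k0 S UNIV \<and>
     (\<forall>x\<in>S. \<forall>y\<in>S. dist x y = path_dist P (k0 x) (k0 y)) \<and>
     S \<subseteq> Sstar \<and> Sstar \<subseteq> closure S \<and> complete Sstar"

definition ram_direction :: "complex poly \<Rightarrow> complex \<Rightarrow> bool" where
  "ram_direction P \<omega> \<longleftrightarrow>
     norm \<omega> = 1 \<and> Im (lead_coeff P * \<omega> ^ degree P) = 0 \<and> Re (lead_coeff P * \<omega> ^ degree P) < 0"

definition ray :: "('s \<Rightarrow> complex) \<Rightarrow> 's set \<Rightarrow> complex \<Rightarrow> real \<Rightarrow> 's" where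
  "ray k0 S \<omega> t = inv_into S k0 (of_real t * \<omega>)"

text \<open>
  A point outside \<open>S\<close> is the limit of exactly one of the rays in the directions \<open>\<omega>\<close> with
  \<^term>\<open>ram_direction P \<omega>\<close>; the value there is the limit of \<open>f\<close> along that ray.
\<close>

definition value_at ::
    "complex poly \<Rightarrow> ('s::metric_space \<Rightarrow> complex) \<Rightarrow> 's set \<Rightarrow> ('s \<Rightarrow> complex) \<Rightarrow> 's \<Rightarrow> complex" where
  "value_at P k0 S f w =
     (if w \<in> S then f w
      else (THE v. \<exists>\<omega>. ram_direction P \<omega> \<and> (ray k0 S \<omega> \<longlongrightarrow> w) at_top \<and>
                       ((\<lambda>t. f (ray k0 S \<omega> t)) \<longlongrightarrow> v) at_top))"

definition point_ideal ::
    "complex poly \<Rightarrow> ('s::metric_space \<Rightarrow> complex) \<Rightarrow> 's set \<Rightarrow> 's \<Rightarrow> ('s \<Rightarrow> complex) set" where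
  "point_ideal P k0 S w = {f \<in> carrier (structural_ring P k0 S). value_at P k0 S f w = 0}"

end

theory Submission
  imports
    Defs
    "HOL-Complex_Analysis.Cauchy_Integral_Theorem"
    "HOL-Real_Asymp.Real_Asymp"
begin

text \<open>
  Write \<open>d\<close> for the degree and \<open>a\<^sub>d\<close> for the leading coefficient of \<open>P\<close>. Evaluation at a point of \<open>Sstar\<close> is a ring homomorphism to the complex numbers
  that is the identity on constants. Its kernel is therefore a maximal ideal, and distinct points have distinct
  kernels as soon as the ring separates points. Three things remain: that evaluation at the points outside \<open>S\<close> is well
  defined, that limits along the rays exist, and the separation of points.
  
  In the chart \<open>k0\<close> the path metric is \<open>\<bar>exp (P z)\<bar> \<bar>dz\<bar>\<close>. The quantity \<open>Q z = \<bar>exp (P z)\<bar> / \<bar>z\<bar>\<^sup>d\<^sup>-\<^sup>1\<close> controls this metric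
  near infinity. On the one hand a path from a large \<open>z\<close> to a distant point has length at least a constant times \<open>Q z\<close>
  (\<open>Q_cost\<close>), so \<open>Q\<close> tends to zero along a Cauchy sequence that escapes to infinity. On the other hand, if \<open>Q z\<close> is small
  and \<open>z\<close> is large, then rotating \<open>z\<close> to the nearest direction \<open>\<omega>\<close> with \<open>a\<^sub>d \<omega>\<^sup>d < 0\<close> costs little (\<open>arc_to_ray\<close>). Hence every point
  outside \<open>S\<close> is the end of such a ray (\<open>ray_to_limit\<close>). It is the end of only one of them, because a short path far
  out cannot switch the nearest direction (\<open>ray_limit_unique\<close>).
  
  On these rays \<open>exp P\<close> decays like \<open>exp (- c t\<^sup>d)\<close>. This gives the limits of all elements of the ring. The element \<open>exp P\<close> of
  the ring vanishes at the points outside \<open>S\<close> and nowhere else, and \<open>exp P\<close> together with \<open>z exp P\<close> separates the points of \<open>S\<close>.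
  The case of two ramification points in directions \<open>\<omega>\<close> and \<open>\<omega>'\<close> is the substantial one (\<open>end_values_separate\<close>). If the primitives of
  \<open>t\<^sup>j exp P\<close> with \<open>j < d\<close> agreed there, then by integration by parts so would those for all \<open>j\<close>. Since \<open>\<omega>\<^sup>d = \<omega>'\<^sup>d\<close>, the function
  \<open>\<omega> exp (P (s \<omega>)) - \<omega>' exp (P (s \<omega>'))\<close> would have vanishing moments with respect to all powers of \<open>s\<^sup>d\<close>. A function with the
  decay \<open>exp (- c s\<^sup>d)\<close> and vanishing moments is zero at the origin (\<open>zero_at_origin\<close>), and so \<open>\<omega> = \<omega>'\<close>.
\<close>

section \<open>The primitives and the path metric\<close>

lemma F_prim_0 [simp]: "F_prim P j 0 = 0"
  by (simp add: F_prim_def contour_integral_trivial)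

lemma has_field_derivative_F_prim:
  "(F_prim P j has_field_derivative z ^ j * exp (poly P z)) (at z)"
proof -
  have "(\<lambda>t. t ^ j * exp (poly P t)) holomorphic_on UNIV"
    by (intro holomorphic_intros)
  then obtain g where g: "\<And>x. (g has_field_derivative x ^ j * exp (poly P x)) (at x)"
    using holomorphic_convex_primitive'[OF convex_UNIV open_UNIV] by auto
  have "F_prim P j w = g w - g 0" for w
    unfolding F_prim_def
    using contour_integral_primitive[of UNIV g "\<lambda>x. x ^ j * exp (poly P x)" "linepath 0 w"] g
    by (auto intro!: contour_integral_unique)
  then have "F_prim P j = (\<lambda>w. g w - g 0)" by auto
  then show ?thesis
    by (auto intro!: derivative_eq_intros g)
qed

lemma F_prim_unique:
  assumes "\<And>z. (G has_field_derivative (\<Sum>j\<in>J. b j * z ^ j) * exp (poly P z)) (at z)" and "finite J"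
  shows "(\<Sum>j\<in>J. b j * F_prim P j z) = G z - G 0"
proof -
  have "\<exists>c. \<forall>x\<in>UNIV. (\<Sum>j\<in>J. b j * F_prim P j x) - G x = c"
  proof (rule has_field_derivative_zero_constant)
    fix x :: complex
    have "((\<lambda>x. (\<Sum>j\<in>J. b j * F_prim P j x) - G x) has_field_derivative
            (\<Sum>j\<in>J. b j * (x ^ j * exp (poly P x))) - (\<Sum>j\<in>J. b j * x ^ j) * exp (poly P x)) (at x)"
      by (intro DERIV_diff DERIV_sum DERIV_cmult has_field_derivative_F_prim assms)
    then show "((\<lambda>x. (\<Sum>j\<in>J. b j * F_prim P j x) - G x) has_field_derivative 0) (at x within UNIV)"
      by (simp add: sum_distrib_right mult.assoc)
  qed auto
  then obtain c where c: "\<And>x. (\<Sum>j\<in>J. b j * F_prim P j x) - G x = c" by blast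
  have "c = - G 0" using c[of 0] by simp
  with c[of z] show ?thesis by (simp add: algebra_simps)
qed

text \<open>
  Since \<open>F_prim P 0\<close> has derivative \<open>exp \<circ> P\<close>, the path metric is the conformal metric
  \<open>\<bar>exp (P z)\<bar> \<bar>dz\<bar>\<close> on the plane. All length estimates below are made in this form.
\<close>

lemma path_dist_speed:
  assumes "(\<gamma> has_vector_derivative D) (at t)"
  shows "norm (vector_derivative (F_prim P 0 \<circ> \<gamma>) (at t)) = norm (exp (poly P (\<gamma> t))) * norm D"
proof -
  have "((F_prim P 0 \<circ> \<gamma>) has_vector_derivative (D * exp (poly P (\<gamma> t)))) (at t)"
    using field_vector_diff_chain_at[OF assms has_field_derivative_F_prim[of P 0]] by simp
  then show ?thesis by (simp add: vector_derivative_at norm_mult)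
qed

text \<open>
  Upper bounds for the distance come from an explicit path whose speed has a majorant \<open>g\<close> with a
  known antiderivative \<open>G\<close>; no length integral is ever evaluated.
\<close>

lemma path_dist_le:
  fixes \<gamma> D :: "real \<Rightarrow> complex" and G g :: "real \<Rightarrow> real"
  assumes \<gamma>: "\<And>s. s \<in> {0..1} \<Longrightarrow> (\<gamma> has_vector_derivative D s) (at s)"
    and D: "continuous_on {0..1} D"
    and G: "\<And>s. s \<in> {0..1} \<Longrightarrow> (G has_real_derivative g s) (at s)"
    and le: "\<And>s. s \<in> {0..1} \<Longrightarrow> norm (exp (poly P (\<gamma> s))) * norm (D s) \<le> g s"
  shows "path_dist P (\<gamma> 0) (\<gamma> 1) \<le> G 1 - G 0"
proof -
  have C1: "\<gamma> C1_differentiable_on {0..1}"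
    using \<gamma> D unfolding C1_differentiable_on_def by blast
  then have v: "valid_path \<gamma>"
    by (simp add: valid_path_def C1_differentiable_imp_piecewise)
  then have cont: "continuous_on {0..1} \<gamma>"
    by (simp add: valid_path_def piecewise_C1_differentiable_on_def)
  let ?h = "\<lambda>t. norm (exp (poly P (\<gamma> t))) * norm (D t)"
  have "?h integrable_on {0..1}"
    by (intro integrable_continuous_interval continuous_intros cont D)
  then obtain L where L: "(?h has_integral L) {0..1}" by blast
  have Gi: "(g has_integral (G 1 - G 0)) {0..1}"
    using G by (intro fundamental_theorem_of_calculus)
       (auto simp: has_real_derivative_iff_has_vector_derivative intro: has_vector_derivative_at_within)
  have LG: "L \<le> G 1 - G 0"
    by (rule has_integral_le[OF L Gi]) (use le in auto)
  have L': "((\<lambda>t. norm (vector_derivative (F_prim P 0 \<circ> \<gamma>) (at t))) has_integral L) {0..1}"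
    by (rule has_integral_eq[OF _ L]) (use path_dist_speed[OF \<gamma>] in auto)
  have "path_dist P (\<gamma> 0) (\<gamma> 1) \<le> L"
    unfolding path_dist_def
  proof (rule cInf_lower)
    show "L \<in> {L. \<exists>\<eta>. valid_path \<eta> \<and> pathstart \<eta> = \<gamma> 0 \<and> pathfinish \<eta> = \<gamma> 1 \<and>
        ((\<lambda>t. norm (vector_derivative (F_prim P 0 \<circ> \<eta>) (at t))) has_integral L) {0..1}}"
      using v L' unfolding pathstart_def pathfinish_def by blast
  next
    show "bdd_below {L. \<exists>\<eta>. valid_path \<eta> \<and> pathstart \<eta> = \<gamma> 0 \<and> pathfinish \<eta> = \<gamma> 1 \<and>
        ((\<lambda>t. norm (vector_derivative (F_prim P 0 \<circ> \<eta>) (at t))) has_integral L) {0..1}}"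
      by (rule bdd_belowI[of _ 0]) (auto elim!: has_integral_nonneg)
  qed
  with LG show ?thesis by linarith
qed

lemma chord_le_length:
  assumes v: "valid_path \<gamma>"
    and L: "((\<lambda>t. norm (vector_derivative (F_prim P 0 \<circ> \<gamma>) (at t))) has_integral L) {0..1}"
    and ab: "0 \<le> \<alpha>" "\<alpha> \<le> \<beta>" "\<beta> \<le> 1" and m: "0 < m"
    and ge: "\<And>t. t \<in> {\<alpha><..<\<beta>} \<Longrightarrow> m \<le> norm (exp (poly P (\<gamma> t)))"
  shows "m * norm (\<gamma> \<beta> - \<gamma> \<alpha>) \<le> L"
proof -
  let ?g = "\<lambda>t. norm (vector_derivative (F_prim P 0 \<circ> \<gamma>) (at t))"
  from v obtain S D where cont: "continuous_on {0..1} \<gamma>" and fin: "finite S"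
    and D: "\<And>t. t \<in> {0..1} - S \<Longrightarrow> (\<gamma> has_vector_derivative D t) (at t)"
    unfolding valid_path_def piecewise_C1_differentiable_on_def C1_differentiable_on_def by blast
  define D' where "D' t = (if t \<in> {\<alpha><..<\<beta>} - S then D t else 0)" for t
  have D'i: "(D' has_integral (\<gamma> \<beta> - \<gamma> \<alpha>)) {\<alpha>..\<beta>}"
    by (rule fundamental_theorem_of_calculus_interior_strong[OF fin ab(2)])
       (use ab D in \<open>auto simp: D'_def intro: continuous_on_subset[OF cont]\<close>)
  have gi: "?g integrable_on {\<alpha>..\<beta>}"
    by (rule integrable_on_subinterval[OF has_integral_integrable[OF L]]) (use ab in auto)
  have "norm (integral {\<alpha>..\<beta>} D') \<le> integral {\<alpha>..\<beta>} (\<lambda>t. ?g t / m)"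
  proof (rule integral_norm_bound_integral)
    fix t assume t: "t \<in> {\<alpha>..\<beta>}"
    show "norm (D' t) \<le> ?g t / m"
    proof (cases "t \<in> {\<alpha><..<\<beta>} - S")
      case True
      then have "?g t = norm (exp (poly P (\<gamma> t))) * norm (D t)"
        using ab by (intro path_dist_speed D) auto
      moreover have "m * norm (D t) \<le> norm (exp (poly P (\<gamma> t))) * norm (D t)"
        using True by (intro mult_right_mono ge) auto
      ultimately show ?thesis using True m by (simp add: D'_def field_simps)
    next
      case False
      then have "D' t = 0" unfolding D'_def by (rule if_not_P)
      then show ?thesis using m by simp
    qed
  qed (use D'i gi in \<open>auto intro: integrable_on_divide\<close>)
  also have "\<dots> = integral {\<alpha>..\<beta>} ?g / m" by simp
  also have "integral {\<alpha>..\<beta>} ?g \<le> integral {0..1} ?g"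
    by (rule integral_subset_le) (use ab gi L in auto)
  also have "integral {0..1} ?g = L" using L by (rule integral_unique)
  finally have "norm (\<gamma> \<beta> - \<gamma> \<alpha>) \<le> L / m"
    using m D'i by (simp add: integral_unique divide_right_mono)
  then show ?thesis using m by (simp add: field_simps)
qed

text \<open>
  The source of all lower bounds for the distance: a path that visits the centre of a disc on which
  the density \<open>\<bar>exp (P z)\<bar>\<close> is at least \<open>m\<close>, and is outside the disc at some other time, earlier or later,
  has crossed the disc radially in between.
\<close>

lemma leaving_ball_cost:
  assumes v: "valid_path \<gamma>"
    and L: "((\<lambda>t. norm (vector_derivative (F_prim P 0 \<circ> \<gamma>) (at t))) has_integral L) {0..1}"
    and \<tau>: "\<tau> \<in> {0..1}" and \<sigma>: "\<sigma> \<in> {0..1}" "\<rho> \<le> dist (\<gamma> \<tau>) (\<gamma> \<sigma>)"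
    and m: "0 < m" and \<rho>: "0 < \<rho>"
    and ge: "\<And>x. x \<in> ball (\<gamma> \<tau>) \<rho> \<Longrightarrow> m \<le> norm (exp (poly P x))"
  shows "m * \<rho> \<le> L"
proof -
  have cont: "continuous_on {0..1} \<gamma>"
    using v by (simp add: valid_path_def piecewise_C1_differentiable_on_def)
  define K where "K = {t \<in> closed_segment \<tau> \<sigma>. \<rho> \<le> dist (\<gamma> \<tau>) (\<gamma> t)}"
  have sub: "closed_segment \<tau> \<sigma> \<subseteq> {0..1}"
    using \<tau> \<sigma> by (simp add: closed_segment_subset)
  have "closed K"
    unfolding K_def
    by (intro continuous_on_closed_Collect_le continuous_intros closed_segment
          continuous_on_subset[OF cont sub])
  then have K: "compact K" "K \<noteq> {}"
    using \<sigma> compact_Int_closed[OF compact_segment, of K \<tau> \<sigma>] unfolding K_def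
    by (auto simp: Int_absorb1 Collect_conj_eq Int_left_absorb)
  \<comment> \<open>the exit from the ball that is nearest in time to \<open>\<tau>\<close>\<close>
  obtain s where s: "s \<in> K" "\<And>t. t \<in> K \<Longrightarrow> \<bar>s - \<tau>\<bar> \<le> \<bar>t - \<tau>\<bar>"
  proof -
    have "continuous_on K (\<lambda>t. \<bar>t - \<tau>\<bar>)" by (intro continuous_intros)
    from continuous_attains_inf[OF K this] show ?thesis using that by blast
  qed
  have s01: "s \<in> {0..1}" using s sub by (auto simp: K_def)
  have inner: "m \<le> norm (exp (poly P (\<gamma> t)))" if "t \<in> {min s \<tau><..<max s \<tau>}" for t
  proof (rule ge)
    have "t \<notin> K" using s(2)[of t] that by (auto simp: min_def max_def split: if_splits)
    moreover have "t \<in> closed_segment \<tau> \<sigma>"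
      using s(1) that by (auto simp: K_def closed_segment_eq_real_ivl split: if_splits)
    ultimately show "\<gamma> t \<in> ball (\<gamma> \<tau>) \<rho>" by (auto simp: K_def)
  qed
  have "m * norm (\<gamma> (max s \<tau>) - \<gamma> (min s \<tau>)) \<le> L"
    by (rule chord_le_length[OF v L]) (use s01 \<tau> m inner in auto)
  moreover have "\<rho> \<le> norm (\<gamma> (max s \<tau>) - \<gamma> (min s \<tau>))"
    using s(1) by (auto simp: K_def dist_norm min_def max_def norm_minus_commute)
  then have "m * \<rho> \<le> m * norm (\<gamma> (max s \<tau>) - \<gamma> (min s \<tau>))"
    using m by simp
  ultimately show ?thesis by linarith
qed

lemma short_path_exists:
  assumes "path_dist P z w < \<epsilon>"
  obtains \<gamma> L where "valid_path \<gamma>" "pathstart \<gamma> = z" "pathfinish \<gamma> = w" "L < \<epsilon>"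
    "((\<lambda>t. norm (vector_derivative (F_prim P 0 \<circ> \<gamma>) (at t))) has_integral L) {0..1}"
proof -
  let ?S = "{L. \<exists>\<gamma>. valid_path \<gamma> \<and> pathstart \<gamma> = z \<and> pathfinish \<gamma> = w \<and>
              ((\<lambda>t. norm (vector_derivative (F_prim P 0 \<circ> \<gamma>) (at t))) has_integral L) {0..1}}"
  let ?\<gamma> = "linepath z w"
  have "(\<lambda>t. norm (exp (poly P (?\<gamma> t))) * norm (w - z)) integrable_on {0..1}"
    by (intro integrable_continuous_interval continuous_intros continuous_on_linepath)
  then obtain L where L: "((\<lambda>t. norm (exp (poly P (?\<gamma> t))) * norm (w - z)) has_integral L) {0..1}" by blast
  have "((\<lambda>t. norm (vector_derivative (F_prim P 0 \<circ> ?\<gamma>) (at t))) has_integral L) {0..1}"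
    by (rule has_integral_eq[OF _ L])
       (simp add: path_dist_speed[OF has_vector_derivative_linepath_within])
  then have "?S \<noteq> {}" by (force intro: exI[of _ ?\<gamma>])
  from cInf_lessD[OF this] assms show ?thesis
    unfolding path_dist_def using that by blast
qed

section \<open>Polynomial growth and ramified directions\<close>

lemma poly_growth:
  fixes p :: "complex poly"
  assumes "degree p \<le> n"
  obtains C where "0 < C" "\<And>x. norm (poly p x) \<le> C * max 1 (norm x) ^ n"
proof
  let ?C = "1 + (\<Sum>i\<le>degree p. norm (Polynomial.coeff p i))"
  show "0 < ?C" by (intro add_pos_nonneg sum_nonneg) auto
  fix x :: complex
  let ?m = "max 1 (norm x)"
  have "norm (poly p x) \<le> (\<Sum>i\<le>degree p. norm (Polynomial.coeff p i) * norm x ^ i)"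
    unfolding poly_altdef by (rule order_trans[OF norm_sum]) (simp add: norm_mult norm_power)
  also have "\<dots> \<le> (\<Sum>i\<le>degree p. norm (Polynomial.coeff p i) * ?m ^ n)"
  proof (intro sum_mono mult_left_mono)
    fix i assume "i \<in> {..degree p}"
    then have "norm x ^ i \<le> ?m ^ i" "?m ^ i \<le> ?m ^ n"
      using assms by (auto intro: power_mono power_increasing)
    then show "norm x ^ i \<le> ?m ^ n" by linarith
  qed auto
  also have "\<dots> = (\<Sum>i\<le>degree p. norm (Polynomial.coeff p i)) * ?m ^ n"
    by (simp add: sum_distrib_right)
  also have "\<dots> \<le> ?C * ?m ^ n" by (intro mult_right_mono) auto
  finally show "norm (poly p x) \<le> ?C * ?m ^ n" .
qed

text \<open>
  Along the rotation of \<open>z\<close> to a ramified direction the leading term of \<open>Re P\<close> is a negative multiple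
  of \<open>cos (\<psi> (1 - s))\<close>. In the border range of \<open>\<psi>\<close>, which contains the direction \<open>\<psi> = pi / 2\<close> where that
  term vanishes, it therefore decreases at least linearly in \<open>s\<close>.
\<close>

lemma cos_increase:
  fixes \<psi> s :: real
  assumes \<psi>: "pi / 3 \<le> \<bar>\<psi>\<bar>" "\<bar>\<psi>\<bar> \<le> 2 * pi / 3" and s: "0 \<le> s" "s \<le> 1"
  shows "cos \<psi> + s / 4 \<le> cos (\<psi> * (1 - s))"
proof -
  define x where "x = \<bar>\<psi>\<bar>"
  have x: "pi / 3 \<le> x" "x \<le> 2 * pi / 3" "0 \<le> x" using \<psi> by (auto simp: x_def)
  have xs: "0 \<le> x * s" "x * s \<le> x"
    using x s by (auto intro: mult_left_le)
  let ?u = "(x * (1 - s) + x) / 2" and ?v = "(x - x * (1 - s)) / 2"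
  have uv: "?u = x - x * s / 2" "?v = x * s / 2" by (simp_all add: field_simps)
  have u: "pi / 6 \<le> ?u" "?u \<le> 5 * pi / 6" unfolding uv using x xs pi_gt_zero by linarith+
  have su: "1 / 2 \<le> sin ?u"
  proof (cases "?u \<le> pi / 2")
    case True
    then have "sin (pi / 6) \<le> sin ?u" using u pi_gt_zero by (intro sin_monotone_2pi_le) auto
    then show ?thesis by (simp add: sin_30)
  next
    case False
    then have "sin (pi / 6) \<le> sin (pi - ?u)" using u pi_gt_zero by (intro sin_monotone_2pi_le) auto
    then show ?thesis by (simp only: sin_30 sin_pi_minus)
  qed
  have v: "0 \<le> ?v" "?v \<le> pi / 3" unfolding uv using x xs by linarith+
  have "sin 0 - 0 / 2 \<le> sin ?v - ?v / 2"
  proof (rule DERIV_nonneg_imp_nondecreasing[OF v(1)])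
    fix y assume y: "0 \<le> y" "y \<le> ?v"
    have "cos (pi / 3) \<le> cos y" using y v pi_gt_zero by (intro cos_monotone_0_pi_le) auto
    then have "0 \<le> cos y - 1 / 2" by (simp add: cos_60)
    then show "\<exists>D. ((\<lambda>x. sin x - x / 2) has_real_derivative D) (at y) \<and> 0 \<le> D"
      by (auto intro!: exI[of _ "cos y - 1 / 2"] derivative_eq_intros)
  qed
  then have "?v / 2 \<le> sin ?v" by simp
  then have "(1 / 2) * (?v / 2) \<le> sin ?u * sin ?v"
    using su v by (intro mult_mono) auto
  moreover have "?v = x * s / 2" by (simp add: algebra_simps)
  moreover have "s * 1 \<le> s * x" using x s pi_gt3 by (intro mult_left_mono) auto
  moreover have "cos (x * (1 - s)) - cos x = 2 * sin ?u * sin ?v"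
    by (simp add: cos_diff_cos)
  ultimately have "cos x + s / 4 \<le> cos (x * (1 - s))" by (simp add: algebra_simps)
  moreover have "cos x = cos \<psi>" "cos (x * (1 - s)) = cos (\<psi> * (1 - s))"
    by (auto simp: x_def abs_if minus_mult_left[symmetric] simp del: mult_minus_left)
  ultimately show ?thesis by simp
qed

lemma vector_derivative_bound:
  fixes f :: "real \<Rightarrow> 'a::real_normed_vector"
  assumes "convex S" and "\<And>x. x \<in> S \<Longrightarrow> (f has_vector_derivative f' x) (at x within S)"
    and "\<And>x. x \<in> S \<Longrightarrow> norm (f' x) \<le> B" and "x \<in> S" "y \<in> S"
  shows "norm (f x - f y) \<le> B * norm (x - y)"
proof (rule differentiable_bound[OF assms(1)])
  fix u assume u: "u \<in> S"
  have "0 \<le> B" using assms(3)[OF u] norm_ge_zero[of "f' u"] by linarith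
  show "onorm (\<lambda>h. h *\<^sub>R f' u) \<le> B"
  proof (rule onorm_bound[OF \<open>0 \<le> B\<close>])
    fix h :: real
    show "norm (h *\<^sub>R f' u) \<le> B * norm h"
      using mult_right_mono[OF assms(3)[OF u], of "\<bar>h\<bar>"] by (simp add: mult.commute)
  qed
qed (use assms in \<open>auto simp: has_vector_derivative_def\<close>)

locale exp_poly =
  fixes P :: "complex poly"
  assumes degree_pos: "degree P \<ge> 1"
begin

definition lower :: "complex poly" where
  "lower = P - Polynomial.monom (lead_coeff P) (degree P)"

definition A :: real where "A = norm (lead_coeff P)"

text \<open>
  The phase of \<open>z\<close> relative to the nearest ramified direction: it vanishes on the ramified rays, and
  \<open>\<bar>exp (P z)\<bar>\<close> is small for \<open>\<bar>\<psi> z\<bar> < pi / 2\<close> and large for \<open>\<bar>\<psi> z\<bar> > pi / 2\<close>, up to lower order terms.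
\<close>

definition \<psi> :: "complex \<Rightarrow> real" where
  "\<psi> z = Arg (- lead_coeff P * z ^ degree P)"

text \<open>
  The nearest ramified direction itself; the principal value of the argument decides ties.
\<close>

definition dir :: "complex \<Rightarrow> complex" where
  "dir z = sgn z * cis (- \<psi> z / degree P)"

text \<open>
  Up to a constant factor this is \<open>\<bar>exp (P z) / P' z\<bar>\<close>, the length that remains when one leaves a large
  \<open>z\<close> along the steepest descent of \<open>Re P\<close>. It decides how \<open>z\<close> lies with respect to the
  infinite ramification points: small \<open>Q z\<close> makes one of them close, and \<open>Q z\<close> bounded away from zero isolates \<open>z\<close>.
\<close>

definition Q :: "complex \<Rightarrow> real" where
  "Q z = norm (exp (poly P z)) / norm z ^ (degree P - 1)"

lemma A_pos: "0 < A"
  using degree_pos by (auto simp: A_def)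

lemma power_degree: "(x::'a::comm_monoid_mult) ^ degree P = x ^ (degree P - 1) * x"
  using degree_pos by (metis One_nat_def Suc_diff_1 Suc_le_eq power_Suc2)

lemma poly_split: "poly P z = lead_coeff P * z ^ degree P + poly lower z"
  by (simp add: lower_def poly_monom)

lemma coeff_lower: "i > degree P - 1 \<Longrightarrow> Polynomial.coeff lower i = 0"
  by (cases "i = degree P") (auto simp: lower_def coeff_eq_0)

text \<open>
  The second bound is for the derivative along a rotation, and is obtained from the polynomial
  \<open>z lower'(z)\<close>, which has degree at most \<open>d - 1\<close> even when \<open>lower\<close> is constant.
\<close>

lemma lower_growth:
  obtains C where "0 < C"
    "\<And>z. norm (poly lower z) \<le> C * max 1 (norm z) ^ (degree P - 1)"
    "\<And>z. norm (z * poly (pderiv lower) z) \<le> C * max 1 (norm z) ^ (degree P - 1)"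
proof -
  have "degree lower \<le> degree P - 1"
    by (rule degree_le) (use coeff_lower in auto)
  then obtain C1 where C1: "0 < C1" "\<And>z. norm (poly lower z) \<le> C1 * max 1 (norm z) ^ (degree P - 1)"
    using poly_growth by blast
  have "degree (pCons 0 (pderiv lower)) \<le> degree P - 1"
    by (rule degree_le) (auto simp: coeff_pCons coeff_pderiv coeff_lower split: nat.split)
  then obtain C2 where C2: "0 < C2"
    "\<And>z. norm (poly (pCons 0 (pderiv lower)) z) \<le> C2 * max 1 (norm z) ^ (degree P - 1)"
    using poly_growth by blast
  show ?thesis
  proof (rule that[of "C1 + C2"])
    show "norm (poly lower z) \<le> (C1 + C2) * max 1 (norm z) ^ (degree P - 1)" for z
      by (rule order_trans[OF C1(2)], rule mult_right_mono) (use C2 in auto)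
    show "norm (z * poly (pderiv lower) z) \<le> (C1 + C2) * max 1 (norm z) ^ (degree P - 1)" for z
      using C2(2)[of z] C1(1)
      by (smt (verit, best) mult_right_mono poly_pCons add_0 zero_le_power norm_ge_zero)
  qed (use C1 C2 in auto)
qed

lemma poly_increment:
  obtains K where "0 < K"
    "\<And>z w. \<lbrakk>1 \<le> norm z; norm (w - z) \<le> 1\<rbrakk> \<Longrightarrow>
        norm (poly P w - poly P z) \<le> K * norm z ^ (degree P - 1) * norm (w - z)"
proof -
  obtain C where C: "0 < C" "\<And>x. norm (poly (pderiv P) x) \<le> C * max 1 (norm x) ^ (degree P - 1)"
    using poly_growth[of "pderiv P" "degree P - 1"] by (auto simp: degree_pderiv)
  show ?thesis
  proof (rule that[of "C * 2 ^ (degree P - 1)"])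
    fix z w :: complex assume z: "1 \<le> norm z" "norm (w - z) \<le> 1"
    show "norm (poly P w - poly P z) \<le> C * 2 ^ (degree P - 1) * norm z ^ (degree P - 1) * norm (w - z)"
    proof (rule field_differentiable_bound[of "cball z 1" "poly P" "poly (pderiv P)"])
      fix x assume x: "x \<in> cball z 1"
      have "norm x \<le> norm z + norm (x - z)" by (rule norm_triangle_sub)
      then have "max 1 (norm x) \<le> 2 * norm z"
        using x z by (auto simp: dist_norm norm_minus_commute)
      then have "max 1 (norm x) ^ (degree P - 1) \<le> (2 * norm z) ^ (degree P - 1)"
        by (intro power_mono) auto
      then have "C * max 1 (norm x) ^ (degree P - 1) \<le> C * (2 * norm z) ^ (degree P - 1)"
        using C by simp
      with C(2)[of x] show "norm (poly (pderiv P) x) \<le> C * 2 ^ (degree P - 1) * norm z ^ (degree P - 1)"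
        by (simp add: power_mult_distrib mult.assoc)
      show "(poly P has_field_derivative poly (pderiv P) x) (at x within cball z 1)"
        by (rule has_field_derivative_at_within[OF poly_DERIV])
    qed (use z in \<open>auto simp: dist_norm norm_minus_commute\<close>)
  qed (use C in auto)
qed

lemma polar: "- lead_coeff P * z ^ degree P = of_real (A * norm z ^ degree P) * cis (\<psi> z)"
  using rcis_cmod_Arg[of "- lead_coeff P * z ^ degree P"]
  by (simp add: \<psi>_def A_def rcis_def norm_mult norm_power)

lemma ram_direction_iff: "ram_direction P \<omega> \<longleftrightarrow> norm \<omega> = 1 \<and> lead_coeff P * \<omega> ^ degree P = - of_real A"
proof -
  have "norm (lead_coeff P * \<omega> ^ degree P) = A" if "norm \<omega> = 1"
    using that by (simp add: norm_mult norm_power A_def)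
  then show ?thesis
    unfolding ram_direction_def using A_pos
    by (auto simp: complex_eq_iff cmod_def abs_if split: if_splits)
qed

lemma cis_degree_power:
  "cis (x / degree P) ^ degree P = cis x" "cis (- (x / degree P)) ^ degree P = cis (- x)"
proof -
  have "degree P \<noteq> 0" using degree_pos by simp
  then show "cis (x / degree P) ^ degree P = cis x" "cis (- (x / degree P)) ^ degree P = cis (- x)"
    by (simp_all add: Complex.DeMoivre)
qed

lemma ram_direction_dir:
  assumes "z \<noteq> 0"
  shows "ram_direction P (dir z)"
proof -
  have "lead_coeff P * dir z ^ degree P = (lead_coeff P * z ^ degree P) * cis (- \<psi> z) / of_real (norm z ^ degree P)"
    using degree_pos assms
    by (simp add: dir_def power_mult_distrib sgn_eq power_divide cis_degree_power)
  also have "lead_coeff P * z ^ degree P = - (of_real (A * norm z ^ degree P) * cis (\<psi> z))"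
    using polar[of z] by (metis minus_minus mult_minus_left)
  also have "\<dots> * cis (- \<psi> z) / of_real (norm z ^ degree P) = - of_real A"
    using assms by (simp add: cis_mult field_simps flip: minus_mult_left)
  finally show ?thesis
    using assms by (simp add: ram_direction_iff dir_def norm_mult norm_sgn)
qed

lemma dir_ray:
  assumes "ram_direction P \<omega>" "t > 0"
  shows "dir (of_real t * \<omega>) = \<omega>"
proof -
  have "- lead_coeff P * (of_real t * \<omega>) ^ degree P = - (lead_coeff P * \<omega> ^ degree P) * of_real (t ^ degree P)"
    by (simp add: power_mult_distrib mult_ac)
  also have "\<dots> = of_real (A * t ^ degree P)"
    using assms by (simp add: ram_direction_iff)
  finally have "\<psi> (of_real t * \<omega>) = 0"
    using assms A_pos by (simp add: \<psi>_def Arg_of_real not_less del: of_real_mult)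
  then show ?thesis using assms
    by (simp add: dir_def ram_direction_iff sgn_eq norm_mult)
qed

lemma finite_ram_direction: "finite {\<omega>. ram_direction P \<omega>}"
proof (rule finite_subset)
  let ?p = "Polynomial.monom (lead_coeff P) (degree P) + [:of_real A:]"
  have "Polynomial.coeff ?p (degree P) \<noteq> 0"
    using degree_pos A_pos by (cases "degree P") (auto simp: A_def coeff_eq_0 simp del: leading_coeff_0_iff)
  then have "?p \<noteq> 0" by (metis coeff_0)
  then show "finite {x. poly ?p x = 0}" by (rule poly_roots_finite)
  show "{\<omega>. ram_direction P \<omega>} \<subseteq> {x. poly ?p x = 0}"
    by (auto simp: ram_direction_iff poly_monom)
qed

lemma Re_poly_polar: "Re (poly P z) = - A * norm z ^ degree P * cos (\<psi> z) + Re (poly lower z)"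
proof -
  have "poly P z = - (of_real (A * norm z ^ degree P) * cis (\<psi> z)) + poly lower z"
    using polar[of z] poly_split[of z] by (metis minus_minus mult_minus_left)
  then show ?thesis by simp
qed

lemma Re_poly_arc:
  assumes "\<gamma> = z * cis (- (s * \<psi> z) / degree P)"
  shows "Re (poly P \<gamma>) = - A * norm z ^ degree P * cos (\<psi> z * (1 - s)) + Re (poly lower \<gamma>)"
proof -
  have "lead_coeff P * \<gamma> ^ degree P = lead_coeff P * z ^ degree P * cis (- (s * \<psi> z))"
    using degree_pos by (simp add: assms power_mult_distrib cis_degree_power)
  also have "lead_coeff P * z ^ degree P = - (of_real (A * norm z ^ degree P) * cis (\<psi> z))"
    using polar[of z] by (metis minus_minus mult_minus_left)
  finally have "lead_coeff P * \<gamma> ^ degree P = - (of_real (A * norm z ^ degree P) * cis (\<psi> z * (1 - s)))"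
    by (simp add: cis_mult algebra_simps)
  then show ?thesis by (simp add: poly_split[of \<gamma>])
qed

end

section \<open>Rotating towards a ramified direction\<close>

context exp_poly
begin

lemma lower_dominated:
  fixes c C :: real
  assumes "0 < c" "0 < C"
  obtains R where "1 \<le> R" "\<And>r. R \<le> r \<Longrightarrow> C * r ^ (degree P - 1) \<le> c * r ^ degree P"
proof (rule that[of "max 1 (C / c)"])
  fix r assume r: "max 1 (C / c) \<le> r"
  then have "C \<le> c * r" using assms by (simp add: field_simps)
  then have "C * r ^ (degree P - 1) \<le> c * r * r ^ (degree P - 1)"
    using r by (intro mult_right_mono) auto
  then show "C * r ^ (degree P - 1) \<le> c * r ^ degree P"
    by (simp add: power_degree mult_ac)
qed simp

lemma le_power_degree: "1 \<le> (r::real) \<Longrightarrow> r \<le> r ^ degree P"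
  using power_increasing[of 1 "degree P" r] degree_pos by simp

lemma psi_bound: "\<bar>\<psi> z\<bar> / degree P \<le> pi"
proof -
  have "\<bar>\<psi> z\<bar> \<le> pi" using Arg_bounded[of "- lead_coeff P * z ^ degree P"] by (auto simp: \<psi>_def)
  moreover have "\<bar>\<psi> z\<bar> / degree P \<le> \<bar>\<psi> z\<bar> / 1"
    using degree_pos by (intro divide_left_mono) auto
  ultimately show ?thesis by simp
qed

lemma arc_derivative:
  "((\<lambda>s. z * cis (- (s * \<psi> z) / degree P)) has_vector_derivative
     z * cis (- (s * \<psi> z) / degree P) * (- \<i> * of_real (\<psi> z / degree P))) (at s)"
proof -
  have "((\<lambda>s. z * exp (\<i> * (- (s * of_real (\<psi> z)) / of_nat (degree P)))) has_field_derivative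
     z * exp (\<i> * (- (of_real s * of_real (\<psi> z)) / of_nat (degree P))) * (- \<i> * of_real (\<psi> z / degree P))) (at (of_real s))"
    using degree_pos by (auto intro!: derivative_eq_intros)
  from has_vector_derivative_real_field[OF this] show ?thesis
    by (simp add: cis_conv_exp o_def)
qed

text \<open>
  The rotation of \<open>z\<close> to its nearest ramified direction, at constant modulus.
\<close>

lemma path_dist_arc:
  fixes z defines "\<gamma> \<equiv> \<lambda>s. z * cis (- (s * \<psi> z) / degree P)"
  assumes z: "z \<noteq> 0"
    and G: "\<And>s. s \<in> {0..1} \<Longrightarrow> (G has_real_derivative g s) (at s)"
    and le: "\<And>s. s \<in> {0..1} \<Longrightarrow> exp (Re (poly P (\<gamma> s))) * (pi * norm z) \<le> g s"
  shows "path_dist P z (of_real (norm z) * dir z) \<le> G 1 - G 0"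
proof -
  have *: "\<gamma> 1 = of_real (norm z) * dir z" "\<gamma> 0 = z"
    using z by (auto simp: \<gamma>_def dir_def sgn_eq)
  let ?D = "\<lambda>s. \<gamma> s * (- \<i> * of_real (\<psi> z / degree P))"
  have deriv: "(\<gamma> has_vector_derivative ?D s) (at s)" for s
    unfolding \<gamma>_def by (rule arc_derivative)
  have "path_dist P (\<gamma> 0) (\<gamma> 1) \<le> G 1 - G 0"
  proof (rule path_dist_le[where D = ?D])
    show "continuous_on {0..1} ?D"
      by (intro continuous_intros continuous_at_imp_continuous_on ballI
            has_vector_derivative_continuous[OF deriv])
  next
    fix s :: real assume s: "s \<in> {0..1}"
    have "norm (?D s) = norm z * (\<bar>\<psi> z\<bar> / degree P)"
      by (simp add: \<gamma>_def norm_mult norm_divide)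
    also have "\<dots> \<le> norm z * pi" by (intro mult_left_mono psi_bound) auto
    finally have "norm (exp (poly P (\<gamma> s))) * norm (?D s) \<le> exp (Re (poly P (\<gamma> s))) * (pi * norm z)"
      by (simp add: mult.commute)
    with le[OF s] show "norm (exp (poly P (\<gamma> s))) * norm (?D s) \<le> g s" by linarith
  qed (use deriv G in auto)
  then show ?thesis unfolding * .
qed

text \<open>
  Here \<open>cos \<ge> 1 / 2\<close> on the whole arc, so that the density is exponentially small throughout.
\<close>

lemma arc_near:
  obtains R where "1 \<le> R"
    "\<And>z. \<lbrakk>R \<le> norm z; \<bar>\<psi> z\<bar> \<le> pi / 3\<rbrakk> \<Longrightarrow>
        path_dist P z (of_real (norm z) * dir z) \<le> pi * norm z * exp (- (A / 4) * norm z)"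
proof -
  obtain C where C: "0 < C" "\<And>z. norm (poly lower z) \<le> C * max 1 (norm z) ^ (degree P - 1)"
    using lower_growth by metis
  obtain R where R: "1 \<le> R" "\<And>r. R \<le> r \<Longrightarrow> C * r ^ (degree P - 1) \<le> A / 4 * r ^ degree P"
    using lower_dominated[of "A / 4" C] A_pos C by auto
  show ?thesis
  proof (rule that[OF R(1)])
    fix z assume z: "R \<le> norm z" "\<bar>\<psi> z\<bar> \<le> pi / 3"
    let ?r = "norm z" and ?M = "pi * norm z * exp (- (A / 4) * norm z)"
    have r1: "1 \<le> ?r" using z R by linarith
    have "path_dist P z (of_real ?r * dir z) \<le> ?M * 1 - ?M * 0"
    proof (rule path_dist_arc)
      fix s :: real assume s: "s \<in> {0..1}"
      define \<gamma> where "\<gamma> = z * cis (- (s * \<psi> z) / degree P)"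
      have n: "norm \<gamma> = ?r" by (simp add: \<gamma>_def norm_mult)
      have "\<bar>\<psi> z * (1 - s)\<bar> \<le> pi / 3"
        using z(2) s mult_mono[of "\<bar>\<psi> z\<bar>" "pi / 3" "1 - s" 1] by (simp add: abs_mult)
      then have "cos (pi / 3) \<le> cos \<bar>\<psi> z * (1 - s)\<bar>"
        using pi_gt_zero by (intro cos_monotone_0_pi_le) auto
      then have "1 / 2 \<le> cos (\<psi> z * (1 - s))" by (simp add: cos_60)
      then have "A * ?r ^ degree P * (1 / 2) \<le> A * ?r ^ degree P * cos (\<psi> z * (1 - s))"
        using A_pos by (intro mult_left_mono) auto
      moreover have "Re (poly lower \<gamma>) \<le> C * ?r ^ (degree P - 1)"
        using C(2)[of \<gamma>] complex_Re_le_cmod[of "poly lower \<gamma>"] n r1 by simp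
      moreover have "A / 4 * ?r \<le> A / 4 * ?r ^ degree P"
        using A_pos le_power_degree[OF r1] by (intro mult_left_mono) auto
      moreover have "Re (poly P \<gamma>) = - A * ?r ^ degree P * cos (\<psi> z * (1 - s)) + Re (poly lower \<gamma>)"
        by (rule Re_poly_arc) (simp add: \<gamma>_def)
      ultimately have "Re (poly P \<gamma>) \<le> - (A / 4) * ?r"
        using R(2)[OF z(1)] by simp
      then show "exp (Re (poly P (z * cis (- (s * \<psi> z) / degree P)))) * (pi * ?r) \<le> ?M"
        unfolding \<gamma>_def[symmetric] by (simp add: mult.commute mult_left_mono)
      show "((\<lambda>s. ?M * s) has_real_derivative ?M) (at s)"
        using DERIV_cmult_Id by blast
    qed (use r1 in auto)
    then show "path_dist P z (of_real ?r * dir z) \<le> ?M" by simp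
  qed
qed

text \<open>
  The density at the start of the arc may be of order one or larger, but by \<open>cos_increase\<close> it decays
  like \<open>exp (- \<beta> s)\<close> with \<open>\<beta>\<close> of order \<open>\<bar>z\<bar>\<^sup>d\<close>. Integrating over an arc of length of order \<open>\<bar>z\<bar>\<close> leaves
  a multiple of \<open>Q z\<close>. The drift of the lower order terms along the arc is at most \<open>C pi \<bar>z\<bar>\<^sup>d\<^sup>-\<^sup>1 s\<close>
  and is absorbed by half of the decrease of the leading term.
\<close>

lemma arc_border:
  obtains R M where "1 \<le> R" "0 < M"
    "\<And>z. \<lbrakk>R \<le> norm z; pi / 3 \<le> \<bar>\<psi> z\<bar>; \<bar>\<psi> z\<bar> \<le> 2 * pi / 3\<rbrakk> \<Longrightarrow>
        path_dist P z (of_real (norm z) * dir z) \<le> M * Q z"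
proof -
  obtain C where C: "0 < C" "\<And>z. norm (z * poly (pderiv lower) z) \<le> C * max 1 (norm z) ^ (degree P - 1)"
    using lower_growth by metis
  obtain R where R: "1 \<le> R" "\<And>r. R \<le> r \<Longrightarrow> (C * pi) * r ^ (degree P - 1) \<le> A / 8 * r ^ degree P"
    using lower_dominated[of "A / 8" "C * pi"] A_pos C by auto
  show ?thesis
  proof (rule that[OF R(1), of "8 * pi / A"])
    fix z assume z: "R \<le> norm z" "pi / 3 \<le> \<bar>\<psi> z\<bar>" "\<bar>\<psi> z\<bar> \<le> 2 * pi / 3"
    let ?r = "norm z" and ?\<beta> = "A / 8 * norm z ^ degree P" and ?p = "Re (poly P z)"
    let ?\<gamma> = "\<lambda>s. z * cis (- (s * \<psi> z) / degree P)"
    have r1: "1 \<le> ?r" using z R by linarith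
    have \<beta>: "0 < ?\<beta>" using A_pos r1 by (intro mult_pos_pos zero_less_power) linarith+
    have drift: "norm (poly lower (?\<gamma> s) - poly lower z) \<le> ?\<beta> * s" if s: "s \<in> {0..1}" for s
    proof -
      have "norm (poly lower (?\<gamma> s) - poly lower (?\<gamma> 0)) \<le> C * ?r ^ (degree P - 1) * pi * norm (s - 0)"
      proof (rule vector_derivative_bound[of "{0..1}"])
        fix u assume "u \<in> {0..1::real}"
        show "((\<lambda>s. poly lower (?\<gamma> s)) has_vector_derivative
           ?\<gamma> u * (- \<i> * of_real (\<psi> z / degree P)) * poly (pderiv lower) (?\<gamma> u)) (at u within {0..1})"
          using field_vector_diff_chain_at[OF arc_derivative[of z u] poly_DERIV[of lower "?\<gamma> u"]]
          by (auto simp: o_def intro: has_vector_derivative_at_within)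
        have "norm (?\<gamma> u * (- \<i> * of_real (\<psi> z / degree P)) * poly (pderiv lower) (?\<gamma> u))
           = norm (?\<gamma> u * poly (pderiv lower) (?\<gamma> u)) * (\<bar>\<psi> z\<bar> / degree P)"
          by (simp add: norm_mult norm_divide)
        also have "\<dots> \<le> (C * max 1 (norm (?\<gamma> u)) ^ (degree P - 1)) * pi"
          using C by (intro mult_mono C(2) psi_bound) auto
        also have "\<dots> = C * ?r ^ (degree P - 1) * pi"
          using r1 by (simp add: norm_mult)
        finally show "norm (?\<gamma> u * (- \<i> * of_real (\<psi> z / degree P)) * poly (pderiv lower) (?\<gamma> u))
            \<le> C * ?r ^ (degree P - 1) * pi" .
      qed (use s in auto)
      also have "\<dots> = (C * pi) * ?r ^ (degree P - 1) * s" using s by simp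
      also have "\<dots> \<le> ?\<beta> * s" using R(2)[OF z(1)] s by (intro mult_right_mono) auto
      finally show ?thesis by simp
    qed
    let ?G = "\<lambda>s. - (pi * ?r * exp ?p / ?\<beta>) * exp (- ?\<beta> * s)"
    have "path_dist P z (of_real ?r * dir z) \<le> ?G 1 - ?G 0"
    proof (rule path_dist_arc)
      fix s :: real assume s: "s \<in> {0..1}"
      have "A * ?r ^ degree P * (cos (\<psi> z) + s / 4) \<le> A * ?r ^ degree P * cos (\<psi> z * (1 - s))"
        using A_pos cos_increase[OF z(2,3), of s] s by (intro mult_left_mono) auto
      moreover have "Re (poly P (?\<gamma> s)) = - A * ?r ^ degree P * cos (\<psi> z * (1 - s)) + Re (poly lower (?\<gamma> s))"
        by (rule Re_poly_arc) simp
      moreover have "Re (poly lower (?\<gamma> s)) \<le> Re (poly lower z) + ?\<beta> * s"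
        using drift[OF s] complex_Re_le_cmod[of "poly lower (?\<gamma> s) - poly lower z"] by simp
      ultimately have "Re (poly P (?\<gamma> s)) \<le> ?p + (- ?\<beta> * s)"
        using Re_poly_polar[of z] by (simp add: algebra_simps)
      then have "exp (Re (poly P (?\<gamma> s))) \<le> exp ?p * exp (- ?\<beta> * s)"
        by (simp only: exp_add[symmetric] exp_le_cancel_iff)
      then have "exp (Re (poly P (?\<gamma> s))) * (pi * ?r) \<le> (exp ?p * exp (- ?\<beta> * s)) * (pi * ?r)"
        by (intro mult_right_mono) auto
      then show "exp (Re (poly P (?\<gamma> s))) * (pi * ?r) \<le> pi * ?r * exp ?p * exp (- ?\<beta> * s)"
        by (simp add: mult_ac)
      have "(?G has_real_derivative - (pi * ?r * exp ?p / ?\<beta>) * (exp (- ?\<beta> * s) * - ?\<beta>)) (at s)"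
        by (auto intro!: derivative_eq_intros)
      moreover have "- (c / b) * (e * - b) = c * e" if "0 < b" for b c e :: real
        using that by simp
      ultimately show "(?G has_real_derivative pi * ?r * exp ?p * exp (- ?\<beta> * s)) (at s)"
        using \<beta> by metis
    qed (use r1 in auto)
    also have "?G 1 - ?G 0 \<le> pi * ?r * exp ?p / ?\<beta>" using \<beta> r1 by simp
    also have "\<dots> = 8 * pi / A * Q z"
    proof -
      have "z \<noteq> 0" using r1 by auto
      then show ?thesis using A_pos by (simp add: Q_def power_degree[of ?r] field_simps)
    qed
    finally show "path_dist P z (of_real ?r * dir z) \<le> 8 * pi / A * Q z" .
  qed (use A_pos in auto)
qed

text \<open>
  For larger \<open>\<psi>\<close> the density grows exponentially in \<open>\<bar>z\<bar>\<^sup>d\<close> and outweighs the denominator of \<open>Q\<close>.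
\<close>

lemma psi_le_if_Q_le_1:
  obtains R where "1 \<le> R" "\<And>z. \<lbrakk>R \<le> norm z; Q z \<le> 1\<rbrakk> \<Longrightarrow> \<bar>\<psi> z\<bar> \<le> 2 * pi / 3"
proof -
  obtain C where C: "0 < C" "\<And>z. norm (poly lower z) \<le> C * max 1 (norm z) ^ (degree P - 1)"
    using lower_growth by metis
  obtain R where R: "1 \<le> R" "\<And>r. R \<le> r \<Longrightarrow> C * r ^ (degree P - 1) \<le> A / 4 * r ^ degree P"
    using lower_dominated[of "A / 4" C] A_pos C by auto
  show ?thesis
  proof (rule that[of "max R (32 / A\<^sup>2)"])
    fix z assume z: "max R (32 / A\<^sup>2) \<le> norm z" "Q z \<le> 1"
    let ?r = "norm z"
    have r1: "1 \<le> ?r" using z R by linarith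
    show "\<bar>\<psi> z\<bar> \<le> 2 * pi / 3"
    proof (rule ccontr)
      assume "\<not> ?thesis"
      moreover have "\<bar>\<psi> z\<bar> \<le> pi" using Arg_bounded[of "- lead_coeff P * z ^ degree P"] by (auto simp: \<psi>_def)
      ultimately have "cos \<bar>\<psi> z\<bar> \<le> cos (2 * pi / 3)"
        using pi_gt_zero by (intro cos_monotone_0_pi_le) auto
      then have "cos (\<psi> z) \<le> - (1 / 2)" by (simp add: cos_120)
      then have "A * ?r ^ degree P * cos (\<psi> z) \<le> A * ?r ^ degree P * (- (1 / 2))"
        using A_pos by (intro mult_left_mono) auto
      moreover have "- Re (poly lower z) \<le> C * ?r ^ (degree P - 1)"
        using C(2)[of z] abs_Re_le_cmod[of "poly lower z"] r1 by simp
      ultimately have "A / 4 * ?r ^ degree P \<le> Re (poly P z)"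
        using Re_poly_polar[of z] R(2)[of ?r] z by simp
      moreover define x where "x = A / 4 * ?r ^ degree P"
      ultimately have "exp x \<le> norm (exp (poly P z))" by simp
      moreover have x: "0 \<le> x" using A_pos by (simp add: x_def)
      have "?r ^ degree P < exp x"
      proof -
        have "32 / A\<^sup>2 \<le> ?r ^ degree P" using z le_power_degree[OF r1] by simp
        then have "?r ^ degree P * 32 \<le> ?r ^ degree P * (A\<^sup>2 * ?r ^ degree P)"
          using A_pos by (intro mult_left_mono) (auto simp: field_simps)
        also have "\<dots> = 16 * x\<^sup>2" by (simp add: x_def power2_eq_square)
        finally have "?r ^ degree P \<le> x\<^sup>2 / 2" by simp
        with exp_lower_Taylor_quadratic[OF x] x show ?thesis by linarith
      qed
      moreover have "?r ^ (degree P - 1) \<le> ?r ^ degree P"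
        using r1 by (intro power_increasing) auto
      ultimately have "?r ^ (degree P - 1) < norm (exp (poly P z))" by linarith
      moreover have "0 < ?r ^ (degree P - 1)" using r1 by (intro zero_less_power) linarith
      ultimately have "1 < Q z" unfolding Q_def by (subst less_divide_eq_1_pos)
      with z show False by simp
    qed
  qed (use R in auto)
qed

lemma arc_to_ray:
  obtains R M where "1 \<le> R"
    "\<And>z. \<lbrakk>R \<le> norm z; Q z \<le> 1\<rbrakk> \<Longrightarrow>
      path_dist P z (of_real (norm z) * dir z) \<le> M * Q z + pi * norm z * exp (- (A / 4) * norm z)"
proof -
  obtain R1 where R1: "1 \<le> R1" "\<And>z. \<lbrakk>R1 \<le> norm z; \<bar>\<psi> z\<bar> \<le> pi / 3\<rbrakk> \<Longrightarrow>
        path_dist P z (of_real (norm z) * dir z) \<le> pi * norm z * exp (- (A / 4) * norm z)"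
    using arc_near by metis
  obtain R2 M where R2: "1 \<le> R2" "0 < M"
    "\<And>z. \<lbrakk>R2 \<le> norm z; pi / 3 \<le> \<bar>\<psi> z\<bar>; \<bar>\<psi> z\<bar> \<le> 2 * pi / 3\<rbrakk> \<Longrightarrow>
        path_dist P z (of_real (norm z) * dir z) \<le> M * Q z"
    using arc_border by metis
  obtain R3 where R3: "1 \<le> R3" "\<And>z. \<lbrakk>R3 \<le> norm z; Q z \<le> 1\<rbrakk> \<Longrightarrow> \<bar>\<psi> z\<bar> \<le> 2 * pi / 3"
    using psi_le_if_Q_le_1 by metis
  show ?thesis
  proof (rule that[of "max R1 (max R2 R3)" M])
    fix z assume z: "max R1 (max R2 R3) \<le> norm z" "Q z \<le> 1"
    have "0 \<le> M * Q z" "0 \<le> pi * norm z * exp (- (A / 4) * norm z)"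
      using R2 by (auto simp: Q_def)
    moreover have "R1 \<le> norm z" "R2 \<le> norm z" "R3 \<le> norm z" using z by auto
    ultimately show "path_dist P z (of_real (norm z) * dir z) \<le> M * Q z + pi * norm z * exp (- (A / 4) * norm z)"
      using R1(2)[of z] R2(3)[of z] R3(2)[of z] z(2) by linarith
  qed (use R1 in auto)
qed

text \<open>
  Near \<open>z\<close> the derivative of \<open>P\<close> is at most \<open>K \<bar>z\<bar>\<^sup>d\<^sup>-\<^sup>1\<close>. On the disc of radius \<open>\<bar>z\<bar>\<^sup>-\<^sup>(\<^sup>d\<^sup>-\<^sup>1\<^sup>)\<close> around
  \<open>z\<close> the density is therefore at least \<open>exp (- K)\<close> times its value at the centre, and crossing that disc
  costs \<open>exp (- K) Q z\<close>. A path that gets at distance \<open>1\<close> from \<open>z\<close> has to cross it.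
\<close>

lemma Q_cost:
  obtains \<kappa> where "0 < \<kappa>"
    "\<And>\<gamma> L \<tau> \<sigma>. \<lbrakk>valid_path \<gamma>;
      ((\<lambda>t. norm (vector_derivative (F_prim P 0 \<circ> \<gamma>) (at t))) has_integral L) {0..1};
      \<tau> \<in> {0..1}; \<sigma> \<in> {0..1}; 1 \<le> dist (\<gamma> \<tau>) (\<gamma> \<sigma>); 1 \<le> norm (\<gamma> \<tau>)\<rbrakk> \<Longrightarrow> \<kappa> * Q (\<gamma> \<tau>) \<le> L"
proof -
  obtain K where K: "0 < K"
    "\<And>z w. \<lbrakk>1 \<le> norm z; norm (w - z) \<le> 1\<rbrakk> \<Longrightarrow>
        norm (poly P w - poly P z) \<le> K * norm z ^ (degree P - 1) * norm (w - z)"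
    using poly_increment by metis
  show ?thesis
  proof (rule that[of "exp (- K)"])
    fix \<gamma> :: "real \<Rightarrow> complex" and L \<tau> \<sigma>
    assume v: "valid_path \<gamma>"
      and L: "((\<lambda>t. norm (vector_derivative (F_prim P 0 \<circ> \<gamma>) (at t))) has_integral L) {0..1}"
      and \<tau>: "\<tau> \<in> {0..1}" and \<sigma>: "\<sigma> \<in> {0..1}" "1 \<le> dist (\<gamma> \<tau>) (\<gamma> \<sigma>)" and n: "1 \<le> norm (\<gamma> \<tau>)"
    define z where "z = \<gamma> \<tau>"
    let ?\<rho> = "1 / norm z ^ (degree P - 1)"
    have n1: "1 \<le> norm z" using n by (simp add: z_def)
    then have p: "1 \<le> norm z ^ (degree P - 1)" by simp
    have \<rho>: "0 < ?\<rho>" "?\<rho> \<le> 1" using p by auto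
    have "exp (Re (poly P z) - K) * ?\<rho> \<le> L"
    proof (rule leaving_ball_cost[OF v L \<tau> \<sigma>(1)])
      show "?\<rho> \<le> dist (\<gamma> \<tau>) (\<gamma> \<sigma>)" using \<rho> \<sigma> by linarith
      fix x assume "x \<in> ball (\<gamma> \<tau>) ?\<rho>"
      then have x: "norm (x - z) \<le> ?\<rho>" by (simp add: z_def dist_norm norm_minus_commute)
      have "norm (poly P x - poly P z) \<le> K * norm z ^ (degree P - 1) * norm (x - z)"
        using K(2)[OF n1, of x] x \<rho> by linarith
      also have "\<dots> \<le> K * norm z ^ (degree P - 1) * ?\<rho>"
        using K x by (intro mult_left_mono) auto
      also have "\<dots> = K" using n1 by auto
      finally have "Re (poly P z) - K \<le> Re (poly P x)"
        using abs_Re_le_cmod[of "poly P x - poly P z"] by simp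
      then show "exp (Re (poly P z) - K) \<le> norm (exp (poly P x))" by simp
    qed (use \<rho> in auto)
    then show "exp (- K) * Q (\<gamma> \<tau>) \<le> L"
      by (simp add: Q_def z_def exp_diff exp_minus field_simps)
  qed simp
qed

end

section \<open>The points added by the completion\<close>

lemma path_dist_near:
  obtains M where "\<And>w. norm (w - z) \<le> 1 \<Longrightarrow> path_dist P w z \<le> M * norm (w - z)"
proof -
  have "compact ((\<lambda>x. norm (exp (poly P x))) ` cball z 1)"
    by (intro compact_continuous_image continuous_intros) auto
  then obtain M where "\<forall>y\<in>(\<lambda>x. norm (exp (poly P x))) ` cball z 1. norm y \<le> M"
    using compact_imp_bounded bounded_iff by metis
  then have M: "\<And>x. x \<in> cball z 1 \<Longrightarrow> norm (exp (poly P x)) \<le> M" by force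
  show ?thesis
  proof (rule that[of M])
    fix w assume w: "norm (w - z) \<le> 1"
    have "path_dist P (linepath w z 0) (linepath w z 1) \<le> M * norm (w - z) * 1 - M * norm (w - z) * 0"
    proof (rule path_dist_le[where D = "\<lambda>_. z - w"])
      fix s :: real assume s: "s \<in> {0..1}"
      show "(linepath w z has_vector_derivative z - w) (at s)"
        by (rule has_vector_derivative_linepath_within)
      show "((\<lambda>s. M * norm (w - z) * s) has_real_derivative M * norm (w - z)) (at s)"
        using DERIV_cmult_Id by blast
      have "linepath w z s \<in> closed_segment w z" using s linepath_in_path by blast
      also have "\<dots> \<subseteq> cball z 1"
        using w by (intro closed_segment_subset) (auto simp: dist_norm norm_minus_commute)
      finally have "norm (exp (poly P (linepath w z s))) \<le> M" by (rule M)
      then show "norm (exp (poly P (linepath w z s))) * norm (z - w) \<le> M * norm (w - z)"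
        by (simp add: norm_minus_commute mult_right_mono)
    qed auto
    then show "path_dist P w z \<le> M * norm (w - z)" by (simp add: linepath_def)
  qed
qed

context exp_poly
begin

lemma ray_decay:
  assumes \<omega>: "ram_direction P \<omega>"
  obtains B where "0 < B"
    "\<And>t. 0 \<le> t \<Longrightarrow> norm (exp (poly P (of_real t * \<omega>))) \<le> B * exp (- (A / 2) * t ^ degree P)"
proof -
  obtain C where C: "0 < C" "\<And>z. norm (poly lower z) \<le> C * max 1 (norm z) ^ (degree P - 1)"
    using lower_growth by metis
  obtain R where R: "1 \<le> R" "\<And>r. R \<le> r \<Longrightarrow> C * r ^ (degree P - 1) \<le> A / 2 * r ^ degree P"
    using lower_dominated[of "A / 2" C] A_pos C by auto
  show ?thesis
  proof (rule that[of "exp (C * R ^ (degree P - 1))"])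
    fix t :: real assume t: "0 \<le> t"
    have n: "norm (of_real t * \<omega>) = t" using \<omega> t by (simp add: ram_direction_iff norm_mult)
    have "lead_coeff P * (of_real t * \<omega>) ^ degree P = lead_coeff P * \<omega> ^ degree P * of_real (t ^ degree P)"
      by (simp add: power_mult_distrib mult_ac)
    also have "\<dots> = of_real (- A * t ^ degree P)" using \<omega> by (simp add: ram_direction_iff)
    finally have "Re (poly P (of_real t * \<omega>)) = - A * t ^ degree P + Re (poly lower (of_real t * \<omega>))"
      by (simp add: poly_split[of "of_real t * \<omega>"] del: of_real_mult of_real_minus)
    moreover have "Re (poly lower (of_real t * \<omega>)) \<le> C * max 1 t ^ (degree P - 1)"
      using C(2)[of "of_real t * \<omega>"] complex_Re_le_cmod[of "poly lower (of_real t * \<omega>)"]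
      unfolding n by linarith
    moreover have "C * max 1 t ^ (degree P - 1) \<le> C * R ^ (degree P - 1) + A / 2 * t ^ degree P"
    proof (cases "t \<le> R")
      case True
      have "C * max 1 t ^ (degree P - 1) \<le> C * R ^ (degree P - 1)"
        using True R C by (intro mult_left_mono power_mono) auto
      moreover have "0 \<le> A / 2 * t ^ degree P" using A_pos t by simp
      ultimately show ?thesis by linarith
    next
      case False
      then have "max 1 t = t" using R by linarith
      then have "C * max 1 t ^ (degree P - 1) \<le> A / 2 * t ^ degree P" using R(2)[of t] False by simp
      moreover have "0 \<le> C * R ^ (degree P - 1)" using C R by simp
      ultimately show ?thesis by linarith
    qed
    ultimately have "Re (poly P (of_real t * \<omega>)) \<le> C * R ^ (degree P - 1) + (- (A / 2) * t ^ degree P)"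
      by simp
    then show "norm (exp (poly P (of_real t * \<omega>))) \<le> exp (C * R ^ (degree P - 1)) * exp (- (A / 2) * t ^ degree P)"
      by (simp only: exp_add[symmetric] norm_exp_eq_Re exp_le_cancel_iff)
  qed simp
qed

lemma ray_decay_linear:
  assumes \<omega>: "ram_direction P \<omega>"
  obtains B where "0 < B"
    "\<And>t. 0 \<le> t \<Longrightarrow> norm (exp (poly P (of_real t * \<omega>))) \<le> B * exp (- (A / 2) * t)"
proof -
  obtain B where B: "0 < B"
    "\<And>t. 0 \<le> t \<Longrightarrow> norm (exp (poly P (of_real t * \<omega>))) \<le> B * exp (- (A / 2) * t ^ degree P)"
    using ray_decay[OF \<omega>] by blast
  show ?thesis
  proof (rule that[of "B * exp (A / 2)"])
    fix t :: real assume t: "0 \<le> t"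
    have "t - 1 \<le> t ^ degree P"
    proof (cases "1 \<le> t")
      case False
      then show ?thesis using zero_le_power[OF t, of "degree P"] by linarith
    qed (use le_power_degree[of t] in linarith)
    then have "A / 2 * (t - 1) \<le> A / 2 * t ^ degree P" using A_pos by (intro mult_left_mono) auto
    then have "- (A / 2) * t ^ degree P \<le> A / 2 + (- (A / 2) * t)" by (simp add: algebra_simps)
    then have "exp (- (A / 2) * t ^ degree P) \<le> exp (A / 2) * exp (- (A / 2) * t)"
      by (simp only: exp_add[symmetric] exp_le_cancel_iff)
    then have "B * exp (- (A / 2) * t ^ degree P) \<le> B * (exp (A / 2) * exp (- (A / 2) * t))"
      using B by (intro mult_left_mono) auto
    with B(2)[OF t] show "norm (exp (poly P (of_real t * \<omega>))) \<le> B * exp (A / 2) * exp (- (A / 2) * t)"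
      by (simp add: mult.assoc)
  qed (use B in auto)
qed

lemma path_dist_ray:
  assumes \<omega>: "ram_direction P \<omega>"
  obtains M where "\<And>s t. \<lbrakk>0 \<le> s; s \<le> t\<rbrakk> \<Longrightarrow>
      path_dist P (of_real s * \<omega>) (of_real t * \<omega>) \<le> M * exp (- (A / 2) * s)"
proof -
  obtain B where B: "0 < B"
    "\<And>t. 0 \<le> t \<Longrightarrow> norm (exp (poly P (of_real t * \<omega>))) \<le> B * exp (- (A / 2) * t)"
    using ray_decay_linear[OF \<omega>] by blast
  let ?c = "A / 2"
  show ?thesis
  proof (rule that[of "B / ?c"])
    fix s t :: real assume st: "0 \<le> s" "s \<le> t"
    let ?u = "\<lambda>x. s + x * (t - s)"
    let ?\<gamma> = "\<lambda>x. of_real (?u x) * \<omega>"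
    let ?G = "\<lambda>x. - (B / ?c) * exp (- ?c * ?u x)"
    have "path_dist P (?\<gamma> 0) (?\<gamma> 1) \<le> ?G 1 - ?G 0"
    proof (rule path_dist_le[where D = "\<lambda>_. of_real (t - s) * \<omega>"])
      fix x :: real assume x: "x \<in> {0..1}"
      have "((\<lambda>x. (s + x * (t - s)) *\<^sub>R \<omega>) has_vector_derivative ((t - s) *\<^sub>R \<omega>)) (at x)"
        by (auto intro!: derivative_eq_intros)
      then show "(?\<gamma> has_vector_derivative of_real (t - s) * \<omega>) (at x)"
        by (simp only: scaleR_conv_of_real)
      have "(?G has_real_derivative - (B / ?c) * (exp (- ?c * ?u x) * (- ?c * (t - s)))) (at x)"
        by (auto intro!: derivative_eq_intros)
      then show "(?G has_real_derivative B * (t - s) * exp (- ?c * ?u x)) (at x)"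
        using A_pos by (simp add: mult_ac)
      have "0 \<le> ?u x" using st x by simp
      from B(2)[OF this]
      have "norm (exp (poly P (?\<gamma> x))) * (t - s) \<le> B * exp (- ?c * ?u x) * (t - s)"
        using st by (intro mult_right_mono) auto
      moreover have "norm (of_real (t - s) * \<omega>) = t - s"
        using \<omega> st by (simp add: ram_direction_iff norm_mult flip: of_real_diff)
      ultimately show "norm (exp (poly P (?\<gamma> x))) * norm (of_real (t - s) * \<omega>) \<le> B * (t - s) * exp (- ?c * ?u x)"
        by (simp only: mult_ac)
    qed auto
    also have "\<dots> \<le> B / ?c * exp (- ?c * s)" using B A_pos by simp
    finally show "path_dist P (of_real s * \<omega>) (of_real t * \<omega>) \<le> B / ?c * exp (- ?c * s)" by simp
  qed
qed

end

locale log_surface = exp_poly +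
  fixes k0 :: "'s::metric_space \<Rightarrow> complex" and S Sstar :: "'s set"
  assumes completed: "completed_log_surface P k0 S Sstar"
begin

abbreviation pt :: "complex \<Rightarrow> 's" where "pt \<equiv> inv_into S k0"

lemma pt_in [simp]: "pt z \<in> S" and k0_pt [simp]: "k0 (pt z) = z"
  using completed unfolding completed_log_surface_def
  by (metis UNIV_I bij_betw_imp_surj_on inv_into_into, metis UNIV_I bij_betw_inv_into_right)

lemma pt_k0 [simp]: "x \<in> S \<Longrightarrow> pt (k0 x) = x"
  using completed unfolding completed_log_surface_def by (metis bij_betw_inv_into_left)

lemma dist_eq: "\<lbrakk>x \<in> S; y \<in> S\<rbrakk> \<Longrightarrow> dist x y = path_dist P (k0 x) (k0 y)"
  using completed by (auto simp: completed_log_surface_def)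

text \<open>
  If the points stayed bounded in the plane, a subsequence would converge in the plane, and by
  \<open>path_dist_near\<close> also in the surface, which would put the limit into \<open>S\<close>.
\<close>

lemma leaving_S:
  assumes x: "\<And>n. x n \<in> S" "x \<longlonglongrightarrow> w" and w: "w \<notin> S"
  shows "filterlim (\<lambda>n. norm (k0 (x n))) at_top sequentially"
  unfolding filterlim_at_top
proof (rule allI, rule ccontr)
  fix Z assume "\<not> (\<forall>\<^sub>F n in sequentially. Z \<le> norm (k0 (x n)))"
  then obtain r :: "nat \<Rightarrow> nat" where r: "strict_mono r" "\<And>n. norm (k0 (x (r n))) < Z"
    using not_eventually_sequentiallyD by (metis not_le)
  have "seq_compact (cball (0::complex) Z)" by (simp add: compact_imp_seq_compact)
  moreover have "\<forall>n. k0 (x (r n)) \<in> cball 0 Z" using r(2) by (auto intro: less_imp_le)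
  ultimately obtain l q where q: "strict_mono q" "((\<lambda>n. k0 (x (r n))) \<circ> q) \<longlonglongrightarrow> l"
    unfolding seq_compact_def by (auto dest!: spec[of _ "\<lambda>n. k0 (x (r n))"])
  obtain M where M: "\<And>v. norm (v - l) \<le> 1 \<Longrightarrow> path_dist P v l \<le> M * norm (v - l)"
    using path_dist_near by blast
  let ?y = "\<lambda>n. x (r (q n))"
  have kl: "(\<lambda>n. norm (k0 (?y n) - l)) \<longlonglongrightarrow> 0"
    using tendsto_norm[OF tendsto_diff[OF q(2) tendsto_const[of l]]] by (simp add: o_def)
  then have "\<forall>\<^sub>F n in sequentially. norm (k0 (?y n) - l) < 1"
    by (rule order_tendstoD) simp
  then have "\<forall>\<^sub>F n in sequentially. norm (dist (?y n) (pt l)) \<le> M * norm (k0 (?y n) - l)"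
  proof eventually_elim
    case (elim n)
    then have "dist (?y n) (pt l) \<le> M * norm (k0 (?y n) - l)" using M x by (simp add: dist_eq)
    then show ?case by simp
  qed
  moreover have "(\<lambda>n. M * norm (k0 (?y n) - l)) \<longlonglongrightarrow> 0" using tendsto_mult_right_zero[OF kl] .
  ultimately have "(\<lambda>n. dist (?y n) (pt l)) \<longlonglongrightarrow> 0" by (rule Lim_null_comparison)
  then have "?y \<longlonglongrightarrow> pt l" by (rule tendsto_dist_iff[THEN iffD2])
  moreover have "?y \<longlonglongrightarrow> w"
    using LIMSEQ_subseq_LIMSEQ[OF LIMSEQ_subseq_LIMSEQ[OF x(2) r(1)] q(1)] by (simp add: o_def)
  ultimately have "w = pt l" by (metis LIMSEQ_unique)
  with w show False by simp
qed

text \<open>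
  Otherwise infinitely many points of the sequence would be isolated by a fixed distance from the later
  ones, which are far away in the plane; but the sequence is Cauchy.
\<close>

lemma Q_tendsto_0:
  assumes x: "\<And>n. x n \<in> S" "x \<longlonglongrightarrow> w" and w: "w \<notin> S"
  shows "(\<lambda>n. Q (k0 (x n))) \<longlonglongrightarrow> 0"
proof (rule tendstoI)
  fix \<epsilon> :: real assume \<epsilon>: "0 < \<epsilon>"
  obtain \<kappa> where \<kappa>: "0 < \<kappa>"
    "\<And>\<gamma> L \<tau> \<sigma>. \<lbrakk>valid_path \<gamma>;
      ((\<lambda>t. norm (vector_derivative (F_prim P 0 \<circ> \<gamma>) (at t))) has_integral L) {0..1};
      \<tau> \<in> {0..1}; \<sigma> \<in> {0..1}; 1 \<le> dist (\<gamma> \<tau>) (\<gamma> \<sigma>); 1 \<le> norm (\<gamma> \<tau>)\<rbrakk> \<Longrightarrow> \<kappa> * Q (\<gamma> \<tau>) \<le> L"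
    using Q_cost by metis
  have inf: "filterlim (\<lambda>n. norm (k0 (x n))) at_top sequentially" by (rule leaving_S[OF assms])
  obtain N where N: "\<And>m n. \<lbrakk>N \<le> m; N \<le> n\<rbrakk> \<Longrightarrow> dist (x m) (x n) < \<kappa> * \<epsilon>"
    using LIMSEQ_imp_Cauchy[OF x(2)] \<kappa> \<epsilon> unfolding Cauchy_def by (meson mult_pos_pos)
  have "\<forall>\<^sub>F n in sequentially. N \<le> n \<and> 1 \<le> norm (k0 (x n))"
    using inf by (auto simp: filterlim_at_top eventually_ge_at_top intro: eventually_conj)
  then show "\<forall>\<^sub>F n in sequentially. dist (Q (k0 (x n))) 0 < \<epsilon>"
  proof eventually_elim
    case (elim n)
    have "\<forall>\<^sub>F m in sequentially. N \<le> m \<and> norm (k0 (x n)) + 1 \<le> norm (k0 (x m))"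
      using inf by (auto simp: filterlim_at_top eventually_ge_at_top intro: eventually_conj)
    then obtain m where m: "N \<le> m" "norm (k0 (x n)) + 1 \<le> norm (k0 (x m))"
      by (auto simp: eventually_sequentially)
    have "path_dist P (k0 (x n)) (k0 (x m)) < \<kappa> * \<epsilon>"
      using N[of n m] m elim x by (simp add: dist_eq)
    then obtain \<gamma> L where \<gamma>: "valid_path \<gamma>" "pathstart \<gamma> = k0 (x n)" "pathfinish \<gamma> = k0 (x m)" "L < \<kappa> * \<epsilon>"
      "((\<lambda>t. norm (vector_derivative (F_prim P 0 \<circ> \<gamma>) (at t))) has_integral L) {0..1}"
      by (rule short_path_exists)
    have ends: "\<gamma> 0 = k0 (x n)" "\<gamma> 1 = k0 (x m)"
      using \<gamma> by (auto simp: pathstart_def pathfinish_def)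
    have "1 \<le> dist (\<gamma> 0) (\<gamma> 1)"
      using m norm_triangle_sub[of "k0 (x m)" "k0 (x n)"] unfolding ends dist_norm
      by (simp add: norm_minus_commute)
    then have "\<kappa> * Q (k0 (x n)) \<le> L"
      using \<kappa>(2)[OF \<gamma>(1,5), of 0 1] elim by (simp add: ends)
    then have "Q (k0 (x n)) < \<epsilon>" using \<gamma>(4) \<kappa>(1) by (meson le_less_trans mult_less_cancel_left_pos)
    then show ?case by (simp add: Q_def)
  qed
qed

lemma ray_eq_pt: "ray k0 S \<omega> t = pt (of_real t * \<omega>)"
  by (simp add: ray_def)

text \<open>
  A sequence in \<open>S\<close> that converges to a new point has \<open>Q\<close> tending to \<open>0\<close>, so that its points can be
  rotated to ramified rays at vanishing cost. There are finitely many ramified directions, hence one of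
  them serves a subsequence, and the whole ray follows because it is Cauchy at infinity.
\<close>

theorem ray_to_limit:
  assumes w: "w \<in> Sstar" "w \<notin> S"
  obtains \<omega> where "ram_direction P \<omega>" "(ray k0 S \<omega> \<longlongrightarrow> w) at_top"
proof -
  have "w \<in> closure S" using w completed by (auto simp: completed_log_surface_def)
  then obtain x where x: "\<And>n. x n \<in> S" "x \<longlonglongrightarrow> w" by (auto simp: closure_sequential)
  let ?z = "\<lambda>n. k0 (x n)"
  have inf: "filterlim (\<lambda>n. norm (?z n)) at_top sequentially" by (rule leaving_S[OF x w(2)])
  have Q0: "(\<lambda>n. Q (?z n)) \<longlonglongrightarrow> 0" by (rule Q_tendsto_0[OF x w(2)])
  have nz: "\<forall>\<^sub>F n in sequentially. dir (?z n) \<in> {\<omega>. ram_direction P \<omega>}"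
    using inf[unfolded filterlim_at_top, rule_format, of 1]
    by eventually_elim (auto intro!: ram_direction_dir)
  have "\<exists>\<omega>. ram_direction P \<omega> \<and> \<not> (\<forall>\<^sub>F n in sequentially. dir (?z n) \<noteq> \<omega>)"
  proof (rule ccontr)
    assume "\<not> ?thesis"
    then have "\<forall>\<omega>\<in>{\<omega>. ram_direction P \<omega>}. \<forall>\<^sub>F n in sequentially. dir (?z n) \<noteq> \<omega>" by auto
    then have "\<forall>\<^sub>F n in sequentially. \<forall>\<omega>\<in>{\<omega>. ram_direction P \<omega>}. dir (?z n) \<noteq> \<omega>"
      by (rule eventually_ball_finite[OF finite_ram_direction])
    with nz have "\<forall>\<^sub>F n::nat in sequentially. False" by eventually_elim auto
    then show False by simp
  qed
  then obtain \<omega> where \<omega>: "ram_direction P \<omega>" and freq: "\<not> (\<forall>\<^sub>F n in sequentially. dir (?z n) \<noteq> \<omega>)"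
    by blast
  obtain r where r: "strict_mono (r :: nat \<Rightarrow> nat)" "\<And>n. dir (?z (r n)) = \<omega>"
    using not_eventually_sequentiallyD[OF freq] by auto
  obtain R M where RM: "\<And>z. \<lbrakk>R \<le> norm z; Q z \<le> 1\<rbrakk> \<Longrightarrow>
      path_dist P z (of_real (norm z) * dir z) \<le> M * Q z + pi * norm z * exp (- (A / 4) * norm z)"
    using arc_to_ray by metis
  let ?t = "\<lambda>n. norm (?z (r n))"
  let ?y = "\<lambda>n. ray k0 S \<omega> (?t n)"
  have sub: "filterlim r sequentially sequentially" using r(1) by (rule filterlim_subseq)
  have inf': "filterlim ?t at_top sequentially" by (rule filterlim_compose[OF inf sub])
  have Q0': "(\<lambda>n. Q (?z (r n))) \<longlonglongrightarrow> 0" by (rule filterlim_compose[OF Q0 sub])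
  have "\<forall>\<^sub>F n in sequentially. Q (?z (r n)) < 1" using Q0' by (rule order_tendstoD) simp
  moreover have "\<forall>\<^sub>F n in sequentially. R \<le> ?t n" using inf' by (simp add: filterlim_at_top)
  ultimately have "\<forall>\<^sub>F n in sequentially. norm (dist (x (r n)) (?y n)) \<le>
      M * Q (?z (r n)) + pi * ?t n * exp (- (A / 4) * ?t n)"
  proof eventually_elim
    case (elim n)
    then have "path_dist P (?z (r n)) (of_real (?t n) * \<omega>) \<le> M * Q (?z (r n)) + pi * ?t n * exp (- (A / 4) * ?t n)"
      using RM[of "?z (r n)"] r(2)[of n] by simp
    then have "dist (x (r n)) (?y n) \<le> M * Q (?z (r n)) + pi * ?t n * exp (- (A / 4) * ?t n)"
      using x by (simp add: dist_eq ray_eq_pt)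
    then show ?case by simp
  qed
  moreover have "((\<lambda>t. pi * t * exp (- (A / 4) * t)) \<longlongrightarrow> 0) at_top"
    using A_pos by real_asymp
  then have "(\<lambda>n. M * Q (?z (r n)) + pi * ?t n * exp (- (A / 4) * ?t n)) \<longlonglongrightarrow> M * 0 + 0"
    by (intro tendsto_intros Q0' filterlim_compose[OF _ inf'])
  then have "(\<lambda>n. M * Q (?z (r n)) + pi * ?t n * exp (- (A / 4) * ?t n)) \<longlonglongrightarrow> 0"
    by simp
  ultimately have xy: "(\<lambda>n. dist (x (r n)) (?y n)) \<longlonglongrightarrow> 0"
    by (rule Lim_null_comparison)
  have xr: "(\<lambda>n. x (r n)) \<longlonglongrightarrow> w" by (rule filterlim_compose[OF x(2) sub])
  have "(\<lambda>n. dist (x (r n)) w) \<longlonglongrightarrow> 0" by (rule tendsto_dist_iff[THEN iffD1, OF xr])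
  with xy have lim0: "(\<lambda>n. dist (x (r n)) (?y n) + dist (x (r n)) w) \<longlonglongrightarrow> 0"
    by (rule tendsto_add_zero)
  have "(\<lambda>n. dist (?y n) w) \<longlonglongrightarrow> 0"
  proof (rule Lim_null_comparison[OF always_eventually lim0], rule allI)
    fix n show "norm (dist (?y n) w) \<le> dist (x (r n)) (?y n) + dist (x (r n)) w"
      using dist_triangle3[of "?y n" w "x (r n)"] by simp
  qed
  then have y: "?y \<longlonglongrightarrow> w" by (rule tendsto_dist_iff[THEN iffD2])
  obtain M' where M': "\<And>s t. \<lbrakk>0 \<le> s; s \<le> t\<rbrakk> \<Longrightarrow>
      path_dist P (of_real s * \<omega>) (of_real t * \<omega>) \<le> M' * exp (- (A / 2) * s)"
    using path_dist_ray[OF \<omega>] by blast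
  have "(ray k0 S \<omega> \<longlongrightarrow> w) at_top"
  proof (rule tendstoI)
    fix \<epsilon> :: real assume \<epsilon>: "0 < \<epsilon>"
    have "((\<lambda>s. M' * exp (- (A / 2) * s)) \<longlongrightarrow> 0) at_top" using A_pos by real_asymp
    then have "\<forall>\<^sub>F s in at_top. M' * exp (- (A / 2) * s) < \<epsilon> / 2"
      by (rule order_tendstoD) (use \<epsilon> in simp)
    then obtain T where T: "\<And>s. T \<le> s \<Longrightarrow> M' * exp (- (A / 2) * s) < \<epsilon> / 2"
      by (auto simp: eventually_at_top_linorder)
    have "\<forall>\<^sub>F n in sequentially. dist (?y n) w < \<epsilon> / 2 \<and> max 0 T \<le> ?t n"
      using tendstoD[OF y, of "\<epsilon> / 2"] \<epsilon> inf' by (intro eventually_conj) (auto simp: filterlim_at_top)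
    then obtain n where n: "dist (?y n) w < \<epsilon> / 2" "max 0 T \<le> ?t n"
      by (auto simp: eventually_sequentially)
    show "\<forall>\<^sub>F t in at_top. dist (ray k0 S \<omega> t) w < \<epsilon>"
      using eventually_ge_at_top[of "max 0 T"]
    proof eventually_elim
      case (elim t)
      have "dist (ray k0 S \<omega> a) (ray k0 S \<omega> b) < \<epsilon> / 2" if "max 0 T \<le> a" "a \<le> b" for a b
        using M'[of a b] T[of a] that by (simp add: dist_eq ray_eq_pt)
      from this[of t "?t n"] this[of "?t n" t] have "dist (ray k0 S \<omega> t) (?y n) < \<epsilon> / 2"
        using elim n(2) by (cases "t \<le> ?t n") (auto simp: dist_commute)
      with n(1) dist_triangle[of "ray k0 S \<omega> t" w "?y n"] show ?case by linarith
    qed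
  qed
  with \<omega> show ?thesis by (rule that)
qed

end

context exp_poly
begin

lemma isCont_dir:
  assumes z: "z \<noteq> 0" and \<psi>: "\<psi> z \<noteq> pi"
  shows "isCont dir z"
proof -
  let ?f = "\<lambda>z. - lead_coeff P * z ^ degree P"
  have "?f z \<noteq> 0" using z A_pos by (auto simp: A_def)
  then have "?f z \<notin> \<real>\<^sub>\<le>\<^sub>0"
    using \<psi> Arg_eq_pi[of "?f z"] by (auto simp: \<psi>_def complex_nonpos_Reals_iff complex_eq_iff le_less)
  then have "isCont Arg (?f z)" by (rule continuous_at_Arg)
  moreover have "isCont ?f z" by (intro continuous_intros)
  ultimately have "isCont (\<lambda>z. Arg (?f z)) z" by (metis isCont_o2)
  then have *: "isCont \<psi> z" unfolding \<psi>_def [abs_def] .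
  show ?thesis
    unfolding dir_def [abs_def] cis_conv_exp sgn_eq
    by (intro continuous_intros *) (use z degree_pos in auto)
qed

end

context log_surface
begin

text \<open>
  Two rays with the same limit are joined far out by arbitrarily short paths. By \<open>Q_cost\<close> such a path
  meets neither a given bounded region nor points with \<open>Q > 1\<close>, so it avoids the locus \<open>\<psi> = pi\<close> where the
  nearest ramified direction jumps. That direction is then a continuous function with finitely many values
  along the path, hence constant. The projection alone could not show this, since different
  ramification points may have the same image.
\<close>

theorem ray_limit_unique:
  assumes \<omega>: "ram_direction P \<omega>" "(ray k0 S \<omega> \<longlongrightarrow> w) at_top"
    and \<omega>': "ram_direction P \<omega>'" "(ray k0 S \<omega>' \<longlongrightarrow> w) at_top"
  shows "\<omega> = \<omega>'"
proof (rule ccontr)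
  assume ne: "\<omega> \<noteq> \<omega>'"
  obtain R where R: "1 \<le> R" "\<And>z. \<lbrakk>R \<le> norm z; Q z \<le> 1\<rbrakk> \<Longrightarrow> \<bar>\<psi> z\<bar> \<le> 2 * pi / 3"
    using psi_le_if_Q_le_1 by metis
  have "compact (cball (0::complex) (R + 1))" "cball (0::complex) (R + 1) \<noteq> {}" using R by auto
  moreover have "continuous_on (cball 0 (R + 1)) (\<lambda>x. norm (exp (poly P x)))"
    by (intro continuous_intros)
  ultimately obtain x0 where x0: "\<And>x. x \<in> cball 0 (R + 1) \<Longrightarrow> norm (exp (poly P x0)) \<le> norm (exp (poly P x))"
    by (meson continuous_attains_inf)
  let ?m = "norm (exp (poly P x0))"
  obtain \<kappa> where \<kappa>: "0 < \<kappa>"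
    "\<And>\<gamma> L \<tau> \<sigma>. \<lbrakk>valid_path \<gamma>;
      ((\<lambda>t. norm (vector_derivative (F_prim P 0 \<circ> \<gamma>) (at t))) has_integral L) {0..1};
      \<tau> \<in> {0..1}; \<sigma> \<in> {0..1}; 1 \<le> dist (\<gamma> \<tau>) (\<gamma> \<sigma>); 1 \<le> norm (\<gamma> \<tau>)\<rbrakk> \<Longrightarrow> \<kappa> * Q (\<gamma> \<tau>) \<le> L"
    using Q_cost by metis
  define \<epsilon> where "\<epsilon> = min ?m \<kappa>"
  have \<epsilon>: "0 < \<epsilon>" using \<kappa> by (simp add: \<epsilon>_def)
  have "\<forall>\<^sub>F t in at_top. dist (ray k0 S \<omega> t) w < \<epsilon> / 2" "\<forall>\<^sub>F t in at_top. dist (ray k0 S \<omega>' t) w < \<epsilon> / 2"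
    using \<omega>(2) \<omega>'(2) \<epsilon> by (auto dest!: tendstoD[where e = "\<epsilon> / 2"])
  moreover have "\<forall>\<^sub>F t in at_top. max 1 (2 / norm (\<omega> - \<omega>')) \<le> t" by (rule eventually_ge_at_top)
  ultimately have "\<forall>\<^sub>F t in at_top. dist (ray k0 S \<omega> t) w < \<epsilon> / 2 \<and> dist (ray k0 S \<omega>' t) w < \<epsilon> / 2
      \<and> max 1 (2 / norm (\<omega> - \<omega>')) \<le> t"
    by eventually_elim blast
  then obtain t where t: "dist (ray k0 S \<omega> t) w < \<epsilon> / 2" "dist (ray k0 S \<omega>' t) w < \<epsilon> / 2"
      "max 1 (2 / norm (\<omega> - \<omega>')) \<le> t"
    by (auto simp: eventually_at_top_linorder)
  have "dist (ray k0 S \<omega> t) (ray k0 S \<omega>' t) < \<epsilon>"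
    using t dist_triangle2[of "ray k0 S \<omega> t" "ray k0 S \<omega>' t" w] by linarith
  then have "path_dist P (of_real t * \<omega>) (of_real t * \<omega>') < \<epsilon>"
    by (simp add: ray_eq_pt dist_eq)
  then obtain \<gamma> L where \<gamma>: "valid_path \<gamma>" "pathstart \<gamma> = of_real t * \<omega>" "pathfinish \<gamma> = of_real t * \<omega>'" "L < \<epsilon>"
      "((\<lambda>t. norm (vector_derivative (F_prim P 0 \<circ> \<gamma>) (at t))) has_integral L) {0..1}"
    by (rule short_path_exists)
  have ends: "\<gamma> 0 = of_real t * \<omega>" "\<gamma> 1 = of_real t * \<omega>'"
    using \<gamma> by (auto simp: pathstart_def pathfinish_def)
  have "2 \<le> t * norm (\<omega> - \<omega>')" using t(3) ne by (simp add: field_simps)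
  moreover have "dist (\<gamma> 0) (\<gamma> 1) = t * norm (\<omega> - \<omega>')"
    using t(3) by (simp add: ends dist_norm norm_mult flip: right_diff_distrib)
  ultimately have far: "2 \<le> dist (\<gamma> 0) (\<gamma> 1)" by simp
  \<comment> \<open>the ends are at distance at least 2, so one of them is at distance at least 1 from any given point of the path\<close>
  have on_path: "\<gamma> \<tau> \<noteq> 0 \<and> \<psi> (\<gamma> \<tau>) \<noteq> pi" if \<tau>: "\<tau> \<in> {0..1}" for \<tau>
  proof -
    obtain \<sigma> where \<sigma>: "\<sigma> \<in> {0..1}" "1 \<le> dist (\<gamma> \<tau>) (\<gamma> \<sigma>)"
    proof (cases "1 \<le> dist (\<gamma> \<tau>) (\<gamma> 0)")
      case True
      then show ?thesis using that[of 0] by simp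
    next
      case False
      then have "1 \<le> dist (\<gamma> \<tau>) (\<gamma> 1)" using far dist_triangle3[of "\<gamma> 0" "\<gamma> 1" "\<gamma> \<tau>"] by linarith
      then show ?thesis using that[of 1] by simp
    qed
    have R': "R < norm (\<gamma> \<tau>)"
    proof (rule ccontr)
      assume le: "\<not> ?thesis"
      have "?m * 1 \<le> L"
      proof (rule leaving_ball_cost[OF \<gamma>(1,5) \<tau> \<sigma>])
        fix x assume "x \<in> ball (\<gamma> \<tau>) 1"
        then have "norm (x - \<gamma> \<tau>) < 1" by (simp add: dist_norm norm_minus_commute)
        then have "norm x \<le> R + 1" using le norm_triangle_sub[of x "\<gamma> \<tau>"] by linarith
        then show "?m \<le> norm (exp (poly P x))" by (intro x0) simp
      qed auto
      then show False using \<gamma>(4) by (simp add: \<epsilon>_def)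
    qed
    then have "\<kappa> * Q (\<gamma> \<tau>) \<le> L" using R by (intro \<kappa>(2)[OF \<gamma>(1,5) \<tau> \<sigma>]) auto
    also have "L < \<kappa> * 1" using \<gamma>(4) by (simp add: \<epsilon>_def)
    finally have "Q (\<gamma> \<tau>) \<le> 1" using \<kappa>(1) by (simp add: mult_less_cancel_left_pos del: mult_1_right)
    then have "\<bar>\<psi> (\<gamma> \<tau>)\<bar> \<le> 2 * pi / 3" using R(2)[of "\<gamma> \<tau>"] R' by linarith
    then show ?thesis using R R' pi_gt_zero by auto
  qed
  have "continuous_on {0..1} (dir \<circ> \<gamma>)"
  proof (rule continuous_on_compose)
    show "continuous_on {0..1} \<gamma>"
      using \<gamma>(1) by (simp add: valid_path_def piecewise_C1_differentiable_on_def)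
    show "continuous_on (\<gamma> ` {0..1}) dir"
      using on_path isCont_dir by (auto intro!: continuous_at_imp_continuous_on)
  qed
  moreover have "finite ((dir \<circ> \<gamma>) ` {0..1})"
    by (rule finite_subset[OF _ finite_ram_direction]) (use on_path ram_direction_dir in auto)
  ultimately have "(dir \<circ> \<gamma>) constant_on {0..1}"
    by (intro continuous_finite_range_constant connected_Icc)
  then have "dir (\<gamma> 0) = dir (\<gamma> 1)" by (force simp: constant_on_def)
  then show False using ne dir_ray[OF \<omega>(1), of t] dir_ray[OF \<omega>'(1), of t] t(3) by (simp add: ends)
qed

end

section \<open>Vanishing moments on the half-line\<close>

abbreviation half_line_integral :: "(real \<Rightarrow> 'a::euclidean_space) \<Rightarrow> 'a" where
  "half_line_integral f \<equiv> set_lebesgue_integral lborel {0..} f"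

lemma half_line_integrable:
  fixes f :: "real \<Rightarrow> 'a::euclidean_space"
  assumes f: "continuous_on {0..} f" and c: "0 < c"
    and le: "\<And>s. 0 \<le> s \<Longrightarrow> norm (f s) \<le> C * exp (- c * s)"
  shows "set_integrable lborel {0..} f"
proof -
  have "(\<lambda>s. exp (- c * s)) absolutely_integrable_on {0..}"
    by (rule nonnegative_absolutely_integrable_1[OF integrable_on_exp_minus_to_infinity[OF c]]) auto
  moreover have "(\<lambda>s. indicator {0..} s *\<^sub>R exp (- c * s)) \<in> borel_measurable lborel"
    by measurable
  ultimately have "set_integrable lborel {0..} (\<lambda>s. exp (- c * s))"
    unfolding set_integrable_def by (simp add: integrable_completion)
  then have "set_integrable lborel {0..} (\<lambda>s. C * exp (- c * s))" by simp
  then show ?thesis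
  proof (rule set_integrable_bound)
    show "set_borel_measurable lborel {0..} f"
      unfolding set_borel_measurable_def
      using borel_measurable_continuous_on_indicator[OF _ f] by simp
    show "AE x in lborel. x \<in> {0..} \<longrightarrow> norm (f x) \<le> norm (C * exp (- c * x))"
      using le by (intro AE_I2) (force intro: order_trans)
  qed
qed

lemma half_line_dominated_convergence:
  fixes f :: "nat \<Rightarrow> real \<Rightarrow> 'a::euclidean_space"
  assumes f: "\<And>n. continuous_on {0..} (f n)" and g: "continuous_on {0..} g" and c: "0 < c"
    and le: "\<And>n s. 0 \<le> s \<Longrightarrow> norm (f n s) \<le> C * exp (- c * s)"
    and lim: "\<And>s. 0 \<le> s \<Longrightarrow> (\<lambda>n. f n s) \<longlonglongrightarrow> g s"
  shows "(\<lambda>n. half_line_integral (f n)) \<longlonglongrightarrow> half_line_integral g"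
  unfolding set_lebesgue_integral_def
proof (rule integral_dominated_convergence)
  have "set_integrable lborel {0..} (\<lambda>s. C * exp (- c * s))"
  proof (rule half_line_integrable[OF _ c])
    fix s :: real assume "0 \<le> s"
    show "norm (C * exp (- c * s)) \<le> \<bar>C\<bar> * exp (- c * s)" by (simp add: abs_mult)
  qed (intro continuous_intros)
  then show "integrable lborel (\<lambda>s. indicator {0..} s *\<^sub>R (C * exp (- c * s)))"
    by (simp add: set_integrable_def)
  show "(\<lambda>s. indicator {0..} s *\<^sub>R f n s) \<in> borel_measurable lborel" for n
    using borel_measurable_continuous_on_indicator[OF _ f[of n]] by simp
  show "(\<lambda>s. indicator {0..} s *\<^sub>R g s) \<in> borel_measurable lborel"
    using borel_measurable_continuous_on_indicator[OF _ g] by simp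
  show "AE s in lborel. (\<lambda>n. indicator {0..} s *\<^sub>R f n s) \<longlonglongrightarrow> indicator {0..} s *\<^sub>R g s"
    using lim by (intro AE_I2) (auto simp: indicator_def)
  show "AE s in lborel. norm (indicator {0..} s *\<^sub>R f n s) \<le> indicator {0..} s *\<^sub>R (C * exp (- c * s))" for n
    using le[of _ n] by (intro AE_I2) (auto simp: indicator_def)
qed

lemma exp_sums: "(\<lambda>j. y ^ j / fact j) sums exp (y::real)"
  using exp_converges[of y] by (simp add: divide_inverse mult.commute)

lemma exp_partial_sum_le:
  fixes y :: real
  assumes "0 \<le> y" "finite I"
  shows "(\<Sum>j\<in>I. y ^ j / fact j) \<le> exp y"
proof -
  have "summable (\<lambda>j. y ^ j / fact j)" "(\<Sum>j. y ^ j / fact j) = exp y"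
    using exp_sums[of y] by (simp_all add: sums_iff)
  with sum_le_suminf[of "\<lambda>j. y ^ j / fact j" I] assms show ?thesis by simp
qed

lemma power_times_exp_bound:
  fixes b :: real
  assumes b: "0 < b" and d: "1 \<le> d"
  obtains C where "\<And>s. 0 \<le> s \<Longrightarrow> (s ^ d) ^ m * exp (- b * s ^ d) \<le> C * exp (- (b / 2) * s)"
proof (rule that[of "(2 / b) ^ m * fact m * exp (b / 2)"])
  fix s :: real assume s: "0 \<le> s"
  define u where "u = s ^ d"
  have u: "0 \<le> u" using s by (simp add: u_def)
  let ?y = "b / 2 * u"
  have y: "0 \<le> ?y" using b u by simp
  have "?y ^ m / fact m \<le> exp ?y"
    using exp_partial_sum_le[OF y, of "{m}"] by simp
  then have "?y ^ m \<le> fact m * exp ?y" by (simp add: field_simps)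
  then have "(2 / b) ^ m * ?y ^ m \<le> (2 / b) ^ m * (fact m * exp ?y)"
    using b by (intro mult_left_mono) auto
  moreover have "(2 / b) ^ m * ?y ^ m = u ^ m"
    using b by (simp flip: power_mult_distrib)
  ultimately have "u ^ m \<le> (2 / b) ^ m * fact m * exp ?y" by (simp add: mult.assoc)
  then have "u ^ m * exp (- b * u) \<le> (2 / b) ^ m * fact m * exp ?y * exp (- b * u)"
    by (intro mult_right_mono) auto
  also have "\<dots> = (2 / b) ^ m * fact m * exp (- (b / 2) * u)"
    by (simp add: mult.assoc exp_add[symmetric] algebra_simps)
  also have "\<dots> \<le> (2 / b) ^ m * fact m * (exp (b / 2) * exp (- (b / 2) * s))"
  proof (intro mult_left_mono)
    have "s - 1 \<le> u"
    proof (cases "1 \<le> s")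
      case True
      then show ?thesis using power_increasing[of 1 d s] d by (simp add: u_def)
    qed (use u in linarith)
    then have "b / 2 * (s - 1) \<le> b / 2 * u" using b by (intro mult_left_mono) auto
    then have "- (b / 2) * u \<le> b / 2 + (- (b / 2) * s)" by (simp add: algebra_simps)
    then show "exp (- (b / 2) * u) \<le> exp (b / 2) * exp (- (b / 2) * s)"
      by (simp only: exp_add[symmetric] exp_le_cancel_iff)
  qed (use b in auto)
  finally show "(s ^ d) ^ m * exp (- b * s ^ d) \<le> (2 / b) ^ m * fact m * exp (b / 2) * exp (- (b / 2) * s)"
    by (simp add: u_def mult.assoc)
qed

text \<open>
  Exponential decay in the variable \<open>u = s\<^sup>d\<close> makes the moment problem determinate: damping by
  \<open>exp (- (c / 2) u)\<close> can be expanded in a power series under the integral sign, which keeps all moments zero.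
  Repeated damping turns this into information about the value at the origin.
\<close>

context
  fixes \<phi> :: "real \<Rightarrow> complex" and d :: nat and B c :: real
  assumes \<phi>: "continuous_on {0..} \<phi>" and d: "1 \<le> d" and c: "0 < c" and B: "0 \<le> B"
    and decay: "\<And>s. 0 \<le> s \<Longrightarrow> norm (\<phi> s) \<le> B * exp (- c * s ^ d)"
    and moments: "\<And>m. half_line_integral (\<lambda>s. of_real ((s ^ d) ^ m) * \<phi> s) = 0"
begin

lemma damped_bound:
  obtains C where "\<And>s y. \<lbrakk>0 \<le> s; \<bar>y\<bar> \<le> (s ^ d) ^ m * exp (c / 2 * s ^ d)\<rbrakk> \<Longrightarrow>
    norm (of_real y * \<phi> s) \<le> C * exp (- (c / 4) * s)"
proof -
  obtain C where C: "\<And>s. 0 \<le> s \<Longrightarrow> (s ^ d) ^ m * exp (- (c / 2) * s ^ d) \<le> C * exp (- (c / 2 / 2) * s)"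
    using power_times_exp_bound[of "c / 2" d m] c d by auto
  show ?thesis
  proof (rule that[of "B * C"])
    fix s y :: real assume s: "0 \<le> s" and y: "\<bar>y\<bar> \<le> (s ^ d) ^ m * exp (c / 2 * s ^ d)"
    have "norm (of_real y * \<phi> s) \<le> ((s ^ d) ^ m * exp (c / 2 * s ^ d)) * (B * exp (- c * s ^ d))"
      unfolding norm_mult norm_of_real using s by (intro mult_mono y decay) auto
    also have "\<dots> = B * ((s ^ d) ^ m * (exp (c / 2 * s ^ d) * exp (- c * s ^ d)))" by simp
    also have "exp (c / 2 * s ^ d) * exp (- c * s ^ d) = exp (- (c / 2) * s ^ d)"
      by (simp flip: exp_add)
    also have "B * ((s ^ d) ^ m * \<dots>) \<le> B * (C * exp (- (c / 2 / 2) * s))"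
      using B by (intro mult_left_mono C s)
    finally show "norm (of_real y * \<phi> s) \<le> B * C * exp (- (c / 4) * s)" by (simp add: mult.assoc)
  qed
qed

text \<open>
  One more factor \<open>exp (- (c / 2) u)\<close> is the limit of its Taylor polynomials, each of which contributes a
  combination of moments that vanish already. The dominating function uses only the decay of \<open>\<phi>\<close>, so the
  damping can be repeated with a fixed step.
\<close>

lemma damped_moments:
  "half_line_integral (\<lambda>s. of_real ((s ^ d) ^ m * exp (- real k * (c / 2) * s ^ d)) * \<phi> s) = 0"
proof (induction k arbitrary: m)
  case 0
  then show ?case using moments by simp
next
  case (Suc k)
  let ?e = "\<lambda>s::real. exp (- real k * (c / 2) * s ^ d)"
  let ?x = "\<lambda>s::real. - (c / 2) * s ^ d"
  let ?f = "\<lambda>N s. of_real ((s ^ d) ^ m * ?e s * (\<Sum>j<N. ?x s ^ j / fact j)) * \<phi> s"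
  let ?g = "\<lambda>s. of_real ((s ^ d) ^ m * exp (- real (Suc k) * (c / 2) * s ^ d)) * \<phi> s"
  have e: "0 \<le> ?e s" "?e s \<le> 1" if "0 \<le> s" for s
    using that c by (auto simp: mult_nonneg_nonneg)
  have fN: "half_line_integral (?f N) = 0" for N
  proof -
    have int: "set_integrable lborel {0..} (\<lambda>s. of_real ((s ^ d) ^ (m + j) * ?e s) * \<phi> s)" for j
    proof -
      obtain C where C: "\<And>s y. \<lbrakk>0 \<le> s; \<bar>y\<bar> \<le> (s ^ d) ^ (m + j) * exp (c / 2 * s ^ d)\<rbrakk> \<Longrightarrow>
          norm (of_real y * \<phi> s) \<le> C * exp (- (c / 4) * s)"
        using damped_bound by blast
      show ?thesis
      proof (rule half_line_integrable[of _ "c / 4" C])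
        fix s :: real assume s: "0 \<le> s"
        have "?e s \<le> exp (c / 2 * s ^ d)" using e[OF s] c s by (smt (verit) one_le_exp_iff zero_le_mult_iff zero_le_power half_gt_zero)
        then show "norm (of_real ((s ^ d) ^ (m + j) * ?e s) * \<phi> s) \<le> C * exp (- (c / 4) * s)"
          using s by (intro C) (auto simp: abs_mult intro!: mult_left_mono)
      qed (use c in \<open>auto intro!: continuous_intros \<phi>\<close>)
    qed
    have "half_line_integral (?f N) =
      half_line_integral (\<lambda>s. \<Sum>j<N. of_real ((- (c / 2)) ^ j / fact j) * (of_real ((s ^ d) ^ (m + j) * ?e s) * \<phi> s))"
    proof (rule arg_cong[of _ _ half_line_integral], rule ext)
      fix s :: real
      have "(s ^ d) ^ m * ?e s * (\<Sum>j<N. ?x s ^ j / fact j) =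
          (\<Sum>j<N. (- (c / 2)) ^ j / fact j * ((s ^ d) ^ (m + j) * ?e s))"
        unfolding sum_distrib_left
        by (intro sum.cong refl, simp only: power_mult_distrib[of "- (c / 2)"])
          (simp only: power_add times_divide_eq_left times_divide_eq_right mult_ac)
      then show "?f N s = (\<Sum>j<N. of_real ((- (c / 2)) ^ j / fact j) * (of_real ((s ^ d) ^ (m + j) * ?e s) * \<phi> s))"
        by (simp only: of_real_sum of_real_mult sum_distrib_right mult.assoc)
    qed
    also have "\<dots> = (\<Sum>j<N. of_real ((- (c / 2)) ^ j / fact j) *
        half_line_integral (\<lambda>s. of_real ((s ^ d) ^ (m + j) * ?e s) * \<phi> s))"
      using int unfolding set_lebesgue_integral_def set_integrable_def
      by (simp add: scaleR_sum_right Bochner_Integration.integral_sum del: of_real_mult of_real_divide of_real_power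
            flip: mult_scaleR_right)
    also have "\<dots> = 0" using Suc.IH by simp
    finally show ?thesis .
  qed
  obtain C where C: "\<And>s y. \<lbrakk>0 \<le> s; \<bar>y\<bar> \<le> (s ^ d) ^ m * exp (c / 2 * s ^ d)\<rbrakk> \<Longrightarrow>
      norm (of_real y * \<phi> s) \<le> C * exp (- (c / 4) * s)"
    using damped_bound by blast
  have "(\<lambda>N. half_line_integral (?f N)) \<longlonglongrightarrow> half_line_integral ?g"
  proof (rule half_line_dominated_convergence[of _ _ "c / 4" C])
    fix s :: real and N assume s: "0 \<le> s"
    have "\<bar>\<Sum>j<N. ?x s ^ j / fact j\<bar> \<le> (\<Sum>j<N. (c / 2 * s ^ d) ^ j / fact j)"
      using s c by (intro order_trans[OF sum_abs] sum_mono)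
        (simp add: abs_mult power_abs abs_divide)
    also have "\<dots> \<le> exp (c / 2 * s ^ d)"
      using s c by (intro exp_partial_sum_le) auto
    finally have "?e s * \<bar>\<Sum>j<N. ?x s ^ j / fact j\<bar> \<le> 1 * exp (c / 2 * s ^ d)"
      using e[OF s] by (intro mult_mono) auto
    then have "(s ^ d) ^ m * (?e s * \<bar>\<Sum>j<N. ?x s ^ j / fact j\<bar>) \<le> (s ^ d) ^ m * exp (c / 2 * s ^ d)"
      using s by (intro mult_left_mono) auto
    moreover define T where "T = (\<Sum>j<N. ?x s ^ j / fact j)"
    ultimately have "\<bar>(s ^ d) ^ m * ?e s * T\<bar> \<le> (s ^ d) ^ m * exp (c / 2 * s ^ d)"
      using s by (simp add: abs_mult mult.assoc)
    then show "norm (?f N s) \<le> C * exp (- (c / 4) * s)"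
      unfolding T_def by (rule C[OF s])
  next
    fix s :: real assume s: "0 \<le> s"
    have "(\<lambda>N. \<Sum>j<N. ?x s ^ j / fact j) \<longlonglongrightarrow> exp (?x s)"
      using exp_sums unfolding sums_def .
    then have "(\<lambda>N. ?f N s) \<longlonglongrightarrow> of_real ((s ^ d) ^ m * ?e s * exp (?x s)) * \<phi> s"
      by (intro tendsto_intros)
    also have "(s ^ d) ^ m * ?e s * exp (?x s) = (s ^ d) ^ m * exp (- real (Suc k) * (c / 2) * s ^ d)"
      by (simp add: mult.assoc exp_add[symmetric] algebra_simps)
    finally show "(\<lambda>N. ?f N s) \<longlonglongrightarrow> ?g s" .
  qed (use c in \<open>auto intro!: continuous_intros \<phi>\<close>)
  then have "(\<lambda>N. 0) \<longlonglongrightarrow> half_line_integral ?g" unfolding fN .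
  then show ?case by (rule LIMSEQ_unique[OF _ tendsto_const])
qed

text \<open>
  The weights \<open>exp (- k (c / 2) s\<^sup>d)\<close> concentrate at the origin as \<open>k\<close> grows. Taking \<open>k = (n + 1)\<^sup>d\<close> makes the
  rescaling rational: the substitution \<open>s / (n + 1)\<close> turns the integral into one with a fixed weight
  and the stretched function \<open>\<phi> (s / (n + 1))\<close>, which tends to the constant \<open>\<phi> 0\<close>.
\<close>

lemma zero_at_origin: "\<phi> 0 = 0"
proof -
  let ?w = "\<lambda>s::real. exp (- (c / 2) * s ^ d)"
  have scaled: "half_line_integral (\<lambda>s. of_real (?w s) * \<phi> (s / real (Suc n))) = 0" for n
  proof -
    let ?h = "\<lambda>s. indicator {0..} s *\<^sub>R (of_real ((s ^ d) ^ 0 * exp (- real (Suc n ^ d) * (c / 2) * s ^ d)) * \<phi> s)"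
    have "(\<integral>s. ?h s \<partial>lborel) = 0"
      using damped_moments[of 0 "Suc n ^ d"] by (simp add: set_lebesgue_integral_def)
    moreover have "(\<integral>s. ?h s \<partial>lborel) = \<bar>1 / real (Suc n)\<bar> *\<^sub>R (\<integral>s. ?h (0 + 1 / real (Suc n) * s) \<partial>lborel)"
      by (rule lborel_integral_real_affine) simp
    moreover have "?h (0 + 1 / real (Suc n) * s) = indicator {0..} s *\<^sub>R (of_real (?w s) * \<phi> (s / real (Suc n)))" for s
    proof -
      have "real (Suc n ^ d) * (c / 2) * (1 / real (Suc n) * s) ^ d = c / 2 * s ^ d"
        by (simp add: power_mult_distrib power_divide del: of_nat_Suc)
      moreover have "0 \<le> 1 / real (Suc n) * s \<longleftrightarrow> 0 \<le> s"
        by (simp add: zero_le_divide_iff del: of_nat_Suc)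
      ultimately show ?thesis by (simp add: indicator_def del: of_nat_Suc of_nat_power)
    qed
    ultimately show ?thesis by (simp add: set_lebesgue_integral_def)
  qed
  obtain C where C: "\<And>s. 0 \<le> s \<Longrightarrow> (s ^ d) ^ 0 * exp (- (c / 2) * s ^ d) \<le> C * exp (- (c / 2 / 2) * s)"
    using power_times_exp_bound[of "c / 2" d 0] c d by auto
  have "(\<lambda>n. half_line_integral (\<lambda>s. of_real (?w s) * \<phi> (s / real (Suc n))))
      \<longlonglongrightarrow> half_line_integral (\<lambda>s. of_real (?w s) * \<phi> 0)"
  proof (rule half_line_dominated_convergence[of _ _ "c / 4" "C * B"])
    show "continuous_on {0..} (\<lambda>s. of_real (?w s) * \<phi> (s / real (Suc n)))" for n
      by (intro continuous_intros continuous_on_compose2[OF \<phi>]) auto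
    fix s :: real assume s: "0 \<le> s"
    have B': "norm (\<phi> t) \<le> B" if "0 \<le> t" for t
    proof -
      have "B * exp (- c * t ^ d) \<le> B * 1" using B c that by (intro mult_left_mono) auto
      with decay[OF that] show ?thesis by linarith
    qed
    show "norm (of_real (?w s) * \<phi> (s / real (Suc n))) \<le> C * B * exp (- (c / 4) * s)" for n
    proof -
      have "?w s * norm (\<phi> (s / real (Suc n))) \<le> (C * exp (- (c / 4) * s)) * B"
        using C[OF s] s by (intro mult_mono B') (auto intro: order_trans[rotated])
      then show ?thesis by (simp add: norm_mult mult_ac)
    qed
    have "(\<lambda>n. s / real (Suc n)) \<longlonglongrightarrow> 0" by real_asymp
    then have "(\<lambda>n. \<phi> (s / real (Suc n))) \<longlonglongrightarrow> \<phi> 0"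
      using s by (intro continuous_on_tendsto_compose[OF \<phi>]) auto
    then show "(\<lambda>n. of_real (?w s) * \<phi> (s / real (Suc n))) \<longlonglongrightarrow> of_real (?w s) * \<phi> 0"
      by (intro tendsto_intros)
  qed (use c in \<open>auto intro!: continuous_intros\<close>)
  then have "(\<lambda>n. 0) \<longlonglongrightarrow> half_line_integral (\<lambda>s. of_real (?w s) * \<phi> 0)" unfolding scaled .
  then have zero: "half_line_integral (\<lambda>s. of_real (?w s) * \<phi> 0) = 0"
    by (rule LIMSEQ_unique[OF _ tendsto_const])
  have int: "set_integrable lborel {0..} ?w"
    using C c by (intro half_line_integrable[of _ "c / 4" C]) (auto intro!: continuous_intros)
  have "half_line_integral (\<lambda>s. of_real (?w s) * \<phi> 0) = of_real (half_line_integral ?w) * \<phi> 0"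
    by (simp only: set_integral_mult_left set_integral_complex_of_real)
  moreover have "0 < half_line_integral ?w"
  proof -
    have "half_line_integral ?w \<ge> (LINT s:{0..1::real}|lborel. exp (- (c / 2)))"
      unfolding set_lebesgue_integral_def
    proof (rule integral_mono)
      show "integrable lborel (\<lambda>s. indicator {0..} s *\<^sub>R ?w s)" using int by (simp add: set_integrable_def)
      show "integrable lborel (\<lambda>s. indicator {0..1::real} s *\<^sub>R exp (- (c / 2)))" by simp
      fix s :: real
      show "indicator {0..1} s *\<^sub>R exp (- (c / 2)) \<le> indicator {0..} s *\<^sub>R ?w s"
        using c by (auto simp: indicator_def power_le_one)
    qed
    moreover have "(LINT s:{0..1::real}|lborel. exp (- (c / 2))) = exp (- (c / 2))"
      by (simp add: set_lebesgue_integral_def)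
    ultimately show ?thesis by (smt (verit) exp_gt_zero)
  qed
  ultimately show ?thesis
    using zero by (metis mult_eq_0_iff of_real_eq_0_iff less_irrefl)
qed

end

section \<open>Values of the primitives at the ramification points\<close>

context exp_poly
begin

text \<open>
  The value of \<open>F_prim P n\<close> at the infinite ramification point in the direction \<open>\<omega>\<close>, for all \<open>n\<close> and not
  only for the \<open>n < degree P\<close> of the structural ring.
\<close>

definition end_value :: "nat \<Rightarrow> complex \<Rightarrow> complex" where
  "end_value n \<omega> = half_line_integral (\<lambda>s. \<omega> * (of_real s * \<omega>) ^ n * exp (poly P (of_real s * \<omega>)))"

lemma ray_eq_pttegrand_integrable:
  assumes \<omega>: "ram_direction P \<omega>"
  shows "set_integrable lborel {0..} (\<lambda>s. \<omega> * (of_real s * \<omega>) ^ n * exp (poly P (of_real s * \<omega>)))"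
proof -
  obtain B where B: "0 < B"
    "\<And>t. 0 \<le> t \<Longrightarrow> norm (exp (poly P (of_real t * \<omega>))) \<le> B * exp (- (A / 2) * t)"
    using ray_decay_linear[OF \<omega>] by blast
  obtain C where C: "\<And>s. 0 \<le> s \<Longrightarrow> (s ^ 1) ^ n * exp (- (A / 2) * s ^ 1) \<le> C * exp (- (A / 2 / 2) * s)"
    using power_times_exp_bound[of "A / 2" 1 n] A_pos by auto
  show ?thesis
  proof (rule half_line_integrable[of _ "A / 4" "B * C"])
    fix s :: real assume s: "0 \<le> s"
    have "norm (\<omega> * (of_real s * \<omega>) ^ n * exp (poly P (of_real s * \<omega>)))
        = s ^ n * norm (exp (poly P (of_real s * \<omega>)))"
      using \<omega> s by (simp add: ram_direction_iff norm_mult norm_power)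
    also have "\<dots> \<le> s ^ n * (B * exp (- (A / 2) * s))"
      using s by (intro mult_left_mono B) auto
    also have "\<dots> = B * ((s ^ 1) ^ n * exp (- (A / 2) * s ^ 1))" by simp
    also have "\<dots> \<le> B * (C * exp (- (A / 2 / 2) * s))"
      using B by (intro mult_left_mono C s) auto
    finally show "norm (\<omega> * (of_real s * \<omega>) ^ n * exp (poly P (of_real s * \<omega>))) \<le> B * C * exp (- (A / 4) * s)"
      by simp
  qed (use A_pos in \<open>auto intro!: continuous_intros\<close>)
qed

lemma F_prim_tendsto_end_value:
  assumes \<omega>: "ram_direction P \<omega>"
  shows "((\<lambda>t. F_prim P n (of_real t * \<omega>)) \<longlongrightarrow> end_value n \<omega>) at_top"
proof -
  let ?g = "\<lambda>s. \<omega> * (of_real s * \<omega>) ^ n * exp (poly P (of_real s * \<omega>))"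
  have int: "set_integrable lborel {0..} ?g" by (rule ray_eq_pttegrand_integrable[OF \<omega>])
  have "((\<lambda>t. set_lebesgue_integral lborel {0..t} ?g) \<longlongrightarrow> end_value n \<omega>) at_top"
    unfolding end_value_def by (rule tendsto_set_lebesgue_integral_at_top[OF _ int]) simp
  moreover have "\<forall>\<^sub>F t in at_top. set_lebesgue_integral lborel {0..t} ?g = F_prim P n (of_real t * \<omega>)"
    using eventually_ge_at_top[of 0]
  proof eventually_elim
    case (elim t)
    have deriv: "((\<lambda>s. F_prim P n (of_real s * \<omega>)) has_vector_derivative ?g s) (at s within {0..t})" for s
    proof -
      have "((\<lambda>s. of_real s * \<omega>) has_vector_derivative \<omega>) (at s)"
        by (auto intro!: derivative_eq_intros)
      from field_vector_diff_chain_at[OF this has_field_derivative_F_prim[of P n]]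
      show ?thesis by (simp add: o_def mult.assoc has_vector_derivative_at_within)
    qed
    have "(?g has_integral F_prim P n (of_real t * \<omega>) - F_prim P n (of_real 0 * \<omega>)) {0..t}"
      by (rule fundamental_theorem_of_calculus[OF elim]) (rule deriv)
    then have "integral {0..t} ?g = F_prim P n (of_real t * \<omega>)"
      by (simp add: integral_unique)
    moreover have "set_integrable lborel {0..t} ?g"
      by (rule set_integrable_subset[OF int]) auto
    ultimately show ?case by (simp only: set_borel_integral_eq_integral(2))
  qed
  ultimately show ?thesis by (rule Lim_transform_eventually)
qed

lemma poly_exp_tendsto_0:
  assumes \<omega>: "ram_direction P \<omega>"
  shows "((\<lambda>t. poly q (of_real t * \<omega>) * exp (poly P (of_real t * \<omega>))) \<longlongrightarrow> 0) at_top"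
proof -
  obtain B where B: "0 < B"
    "\<And>t. 0 \<le> t \<Longrightarrow> norm (exp (poly P (of_real t * \<omega>))) \<le> B * exp (- (A / 2) * t)"
    using ray_decay_linear[OF \<omega>] by blast
  obtain C where C: "0 < C" "\<And>x. norm (poly q x) \<le> C * max 1 (norm x) ^ degree q"
    using poly_growth[of q "degree q"] by auto
  obtain C' where C': "\<And>s. 0 \<le> s \<Longrightarrow> (s ^ 1) ^ degree q * exp (- (A / 2) * s ^ 1) \<le> C' * exp (- (A / 2 / 2) * s)"
    using power_times_exp_bound[of "A / 2" 1 "degree q"] A_pos by auto
  have "((\<lambda>t. C * (B * (C' * exp (- (A / 2 / 2) * t)))) \<longlongrightarrow> 0) at_top"
    using A_pos by real_asymp
  moreover have "\<forall>\<^sub>F t in at_top. norm (poly q (of_real t * \<omega>) * exp (poly P (of_real t * \<omega>)))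
      \<le> C * (B * (C' * exp (- (A / 2 / 2) * t)))"
    using eventually_ge_at_top[of 1]
  proof eventually_elim
    case (elim t)
    have "norm (of_real t * \<omega>) = t" using \<omega> elim by (simp add: ram_direction_iff norm_mult)
    then have "norm (poly q (of_real t * \<omega>)) \<le> C * t ^ degree q"
      using C(2)[of "of_real t * \<omega>"] elim by simp
    then have "norm (poly q (of_real t * \<omega>) * exp (poly P (of_real t * \<omega>)))
        \<le> (C * t ^ degree q) * (B * exp (- (A / 2) * t))"
      unfolding norm_mult using elim C B by (intro mult_mono B) auto
    also have "\<dots> = C * (B * ((t ^ 1) ^ degree q * exp (- (A / 2) * t ^ 1)))" by simp
    also have "\<dots> \<le> C * (B * (C' * exp (- (A / 2 / 2) * t)))"
      using B C elim by (intro mult_left_mono C') auto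
    finally show ?case .
  qed
  ultimately show ?thesis by (rule Lim_null_comparison[rotated])
qed

lemma integration_by_parts:
  fixes r defines "q \<equiv> pderiv r + r * pderiv P"
  shows "(\<Sum>j\<le>degree q. Polynomial.coeff q j * F_prim P j z) =
    poly r z * exp (poly P z) - poly r 0 * exp (poly P 0)"
proof (rule F_prim_unique)
  fix z
  have "((\<lambda>z. poly r z * exp (poly P z)) has_field_derivative
      (poly (pderiv r) z + poly r z * poly (pderiv P) z) * exp (poly P z)) (at z)"
    by (auto intro!: derivative_eq_intros simp: algebra_simps)
  moreover have "poly (pderiv r) z + poly r z * poly (pderiv P) z = poly q z"
    by (simp add: q_def)
  ultimately show "((\<lambda>z. poly r z * exp (poly P z)) has_field_derivative
      (\<Sum>j\<le>degree q. Polynomial.coeff q j * z ^ j) * exp (poly P z)) (at z)"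
    by (simp only: poly_altdef[of q])
qed simp

text \<open>
  Integration by parts up to the ramification point; the boundary term at the origin does not depend on
  the direction, which is why differences of end values satisfy a homogeneous recurrence.
\<close>

lemma end_value_relation:
  fixes r defines "q \<equiv> pderiv r + r * pderiv P"
  assumes \<omega>: "ram_direction P \<omega>"
  shows "(\<Sum>j\<le>degree q. Polynomial.coeff q j * end_value j \<omega>) = - poly r 0 * exp (poly P 0)"
proof (rule tendsto_unique[OF trivial_limit_at_top_linorder])
  let ?f = "\<lambda>t::real. \<Sum>j\<le>degree q. Polynomial.coeff q j * F_prim P j (of_real t * \<omega>)"
  show "(?f \<longlongrightarrow> (\<Sum>j\<le>degree q. Polynomial.coeff q j * end_value j \<omega>)) at_top"
    by (intro tendsto_intros F_prim_tendsto_end_value \<omega>)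
  have "(?f \<longlongrightarrow> 0 - poly r 0 * exp (poly P 0)) at_top"
    unfolding q_def integration_by_parts by (intro tendsto_intros poly_exp_tendsto_0 \<omega>)
  then show "(?f \<longlongrightarrow> - poly r 0 * exp (poly P 0)) at_top" by simp
qed

text \<open>
  With \<open>r = z\<^sup>m\<close> and \<open>m > 0\<close> the relation has top index \<open>n = m + d - 1\<close> with a nonzero coefficient and no
  boundary term, and so expresses the \<open>n\<close>-th end value through the previous ones.
\<close>

lemma end_values_determined:
  assumes \<omega>: "ram_direction P \<omega>" "ram_direction P \<omega>'"
    and eq: "\<And>j. j < degree P \<Longrightarrow> end_value j \<omega> = end_value j \<omega>'"
  shows "end_value n \<omega> = end_value n \<omega>'"
proof (induction n rule: less_induct)
  case (less n)
  show ?case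
  proof (cases "n < degree P")
    case False
    define m where "m = n - (degree P - 1)"
    have m: "0 < m" "n = m + (degree P - 1)" using False degree_pos by (auto simp: m_def)
    let ?r = "Polynomial.monom (1::complex) m"
    define q where "q = pderiv ?r + ?r * pderiv P"
    have dP: "pderiv P \<noteq> 0" using degree_pos by (simp add: pderiv_eq_0_iff)
    have "degree (?r * pderiv P) = n"
      using m dP by (simp add: degree_mult_eq degree_monom_eq degree_pderiv)
    moreover have "degree (pderiv ?r) < n"
      using m by (simp add: degree_pderiv degree_monom_eq)
    ultimately have deg: "degree q = n" unfolding q_def by (subst degree_add_eq_right) auto
    have "q \<noteq> 0" using deg m by auto
    then have lead: "Polynomial.coeff q n \<noteq> 0" using deg leading_coeff_0_iff by blast
    have split: "(\<Sum>j\<le>n. Polynomial.coeff q j * e j) = (\<Sum>j<n. Polynomial.coeff q j * e j) + Polynomial.coeff q n * e n" for e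
      by (simp add: lessThan_Suc_atMost[symmetric])
    have "(\<Sum>j\<le>n. Polynomial.coeff q j * end_value j \<omega>) = (\<Sum>j\<le>n. Polynomial.coeff q j * end_value j \<omega>')"
      using end_value_relation[OF \<omega>(1), of ?r] end_value_relation[OF \<omega>(2), of ?r]
      unfolding q_def[symmetric] deg by simp
    moreover have "(\<Sum>j<n. Polynomial.coeff q j * end_value j \<omega>) = (\<Sum>j<n. Polynomial.coeff q j * end_value j \<omega>')"
      using less by (intro sum.cong) auto
    ultimately show ?thesis using lead by (simp add: split)
  qed (rule eq)
qed

text \<open>
  Equal end values of the first \<open>d\<close> primitives are equal end values of all of them. Restricted to the exponents
  \<open>d m\<close>, for which \<open>\<omega>\<^sup>d\<^sup>m\<close> is the same for all ramified directions, they say that the moments in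
  \<open>s\<^sup>d\<close> of \<open>\<omega> exp (P (s \<omega>)) - \<omega>' exp (P (s \<omega>'))\<close> vanish. The value of this function at the origin is
  \<open>(\<omega> - \<omega>') exp (P 0)\<close>.
\<close>

theorem end_values_separate:
  assumes \<omega>: "ram_direction P \<omega>" and \<omega>': "ram_direction P \<omega>'"
    and eq: "\<And>j. j < degree P \<Longrightarrow> end_value j \<omega> = end_value j \<omega>'"
  shows "\<omega> = \<omega>'"
proof -
  let ?\<phi> = "\<lambda>s. \<omega> * exp (poly P (of_real s * \<omega>)) - \<omega>' * exp (poly P (of_real s * \<omega>'))"
  define \<kappa> where "\<kappa> = \<omega> ^ degree P"
  have "lead_coeff P * \<omega> ^ degree P = lead_coeff P * \<omega>' ^ degree P"
    using \<omega> \<omega>' by (simp add: ram_direction_iff)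
  then have \<kappa>': "\<kappa> = \<omega>' ^ degree P" using A_pos by (simp add: \<kappa>_def A_def)
  have \<kappa>: "\<kappa> \<noteq> 0" using \<omega> by (auto simp: \<kappa>_def ram_direction_iff)
  obtain B where B: "0 < B"
    "\<And>t. 0 \<le> t \<Longrightarrow> norm (exp (poly P (of_real t * \<omega>))) \<le> B * exp (- (A / 2) * t ^ degree P)"
    using ray_decay[OF \<omega>] by blast
  obtain B' where B': "0 < B'"
    "\<And>t. 0 \<le> t \<Longrightarrow> norm (exp (poly P (of_real t * \<omega>'))) \<le> B' * exp (- (A / 2) * t ^ degree P)"
    using ray_decay[OF \<omega>'] by blast
  have "?\<phi> 0 = 0"
  proof (rule zero_at_origin[of ?\<phi> "degree P" "A / 2" "B + B'"])
    fix s :: real assume s: "0 \<le> s"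
    have "norm (?\<phi> s) \<le> norm (\<omega> * exp (poly P (of_real s * \<omega>))) + norm (\<omega>' * exp (poly P (of_real s * \<omega>')))"
      by (rule norm_triangle_ineq4)
    also have "\<dots> \<le> B * exp (- (A / 2) * s ^ degree P) + B' * exp (- (A / 2) * s ^ degree P)"
      using B(2)[OF s] B'(2)[OF s] \<omega> \<omega>' by (simp add: ram_direction_iff norm_mult)
    finally show "norm (?\<phi> s) \<le> (B + B') * exp (- (A / 2) * s ^ degree P)"
      by (simp add: distrib_right)
  next
    fix m
    let ?h = "\<lambda>\<omega> s. of_real ((s ^ degree P) ^ m) * (\<omega> * exp (poly P (of_real s * \<omega>)))"
    have h: "\<kappa> ^ m * ?h \<eta> s = \<eta> * (of_real s * \<eta>) ^ (degree P * m) * exp (poly P (of_real s * \<eta>))"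
      if "\<kappa> = \<eta> ^ degree P" for \<eta> s
      unfolding that power_mult[of _ "degree P" m] power_mult_distrib of_real_power by (simp only: mult_ac)
    have end_eq: "end_value (degree P * m) \<eta> = \<kappa> ^ m * half_line_integral (?h \<eta>)"
      and int: "set_integrable lborel {0..} (?h \<eta>)"
      if "\<kappa> = \<eta> ^ degree P" "ram_direction P \<eta>" for \<eta>
    proof -
      show "end_value (degree P * m) \<eta> = \<kappa> ^ m * half_line_integral (?h \<eta>)"
        unfolding end_value_def h[OF that(1), symmetric] by (rule set_integral_mult_right)
      have "set_integrable lborel {0..} (\<lambda>s. \<kappa> ^ m * ?h \<eta> s)"
        unfolding h[OF that(1)] by (rule ray_eq_pttegrand_integrable[OF that(2)])
      then show "set_integrable lborel {0..} (?h \<eta>)" using \<kappa> by simp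
    qed
    have "end_value (degree P * m) \<omega> = end_value (degree P * m) \<omega>'"
      by (rule end_values_determined[OF \<omega> \<omega>' eq])
    then have "half_line_integral (?h \<omega>) = half_line_integral (?h \<omega>')"
      using \<kappa> by (simp only: end_eq[OF \<kappa>_def \<omega>] end_eq[OF \<kappa>' \<omega>']) simp
    moreover have "half_line_integral (\<lambda>s. ?h \<omega> s - ?h \<omega>' s) = half_line_integral (?h \<omega>) - half_line_integral (?h \<omega>')"
      by (rule set_integral_diff(2)[OF int[OF \<kappa>_def \<omega>] int[OF \<kappa>' \<omega>']])
    ultimately show "half_line_integral (\<lambda>s. of_real ((s ^ degree P) ^ m) * ?\<phi> s) = 0"
      by (simp only: right_diff_distrib) simp
  qed (use A_pos B B' degree_pos in \<open>auto intro!: continuous_intros\<close>)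
  then show ?thesis by simp
qed

end

section \<open>The structural ring and its point ideals\<close>

lemma entire_ring_simps [simp]:
  "carrier entire_ring = {f. f holomorphic_on UNIV}"
  "mult entire_ring f g = (\<lambda>z. f z * g z)" "one entire_ring = (\<lambda>z. 1)"
  "zero entire_ring = (\<lambda>z. 0)" "add entire_ring f g = (\<lambda>z. f z + g z)"
  by (simp_all add: entire_ring_def)

lemma ring_entire_ring: "ring entire_ring"
proof (rule ringI)
  show "abelian_group entire_ring"
  proof (rule abelian_groupI)
    fix f assume "f \<in> carrier entire_ring"
    then show "\<exists>g\<in>carrier entire_ring. g \<oplus>\<^bsub>entire_ring\<^esub> f = \<zero>\<^bsub>entire_ring\<^esub>"
      by (intro bexI[of _ "\<lambda>z. - f z"]) (auto intro!: holomorphic_intros)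
  qed (auto intro!: holomorphic_intros simp: add_ac)
  show "monoid entire_ring"
    by (rule monoidI) (auto intro!: holomorphic_intros simp: mult_ac)
qed (auto simp: algebra_simps)

lemma a_inv_entire_ring: "f holomorphic_on UNIV \<Longrightarrow> \<ominus>\<^bsub>entire_ring\<^esub> f = (\<lambda>z. - f z)"
  by (rule abelian_group.minus_equality[OF ring.is_abelian_group[OF ring_entire_ring]])
     (auto intro!: holomorphic_intros)

lemma F_prim_holomorphic: "F_prim P j holomorphic_on UNIV"
  using has_field_derivative_F_prim by (auto simp: holomorphic_on_def field_differentiable_def
    intro: has_field_derivative_at_within)

lemma V_space_holomorphic: "V_space P \<subseteq> carrier entire_ring"
  unfolding V_space_def
  by (auto intro!: holomorphic_intros F_prim_holomorphic)

lemma A_ring_holomorphic: "G \<in> A_ring P \<Longrightarrow> G holomorphic_on UNIV"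
  using ring.generate_ring_in_carrier[OF ring_entire_ring V_space_holomorphic]
  by (auto simp: A_ring_def)

lemma A_ring_V: "G \<in> V_space P \<Longrightarrow> G \<in> A_ring P"
  unfolding A_ring_def by (rule generate_ring.incl)

lemma A_ring_add: "\<lbrakk>G \<in> A_ring P; H \<in> A_ring P\<rbrakk> \<Longrightarrow> (\<lambda>z. G z + H z) \<in> A_ring P"
  using generate_ring.eng_add[of _ entire_ring] by (simp add: A_ring_def)

lemma A_ring_mult: "\<lbrakk>G \<in> A_ring P; H \<in> A_ring P\<rbrakk> \<Longrightarrow> (\<lambda>z. G z * H z) \<in> A_ring P"
  using generate_ring.eng_mult[of _ entire_ring] by (simp add: A_ring_def)

lemma V_spaceI:
  "(\<lambda>z. z * poly q z * exp (poly P z) + c + (\<Sum>j<degree P. b j * F_prim P j z)) \<in> V_space P"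
  unfolding V_space_def by blast

lemma A_ring_const: "(\<lambda>z. c) \<in> A_ring P"
  using V_spaceI[of 0 P c "\<lambda>_. 0"] by (intro A_ring_V) simp

lemma A_ring_uminus: "G \<in> A_ring P \<Longrightarrow> (\<lambda>z. - G z) \<in> A_ring P"
  using A_ring_mult[OF A_ring_const[of "-1"]] by simp

lemma A_ring_monomial_exp: "(\<lambda>z. z ^ Suc k * exp (poly P z)) \<in> A_ring P"
  using V_spaceI[of "Polynomial.monom 1 k" P 0 "\<lambda>_. 0"] by (intro A_ring_V) (simp add: poly_monom)

lemma A_ring_F_prim:
  assumes "i < degree P" shows "F_prim P i \<in> A_ring P"
proof -
  have "(\<Sum>j<degree P. (if j = i then 1 else 0) * F_prim P j z) = F_prim P i z" for z
    using assms by (subst sum.remove[of _ i]) auto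
  then show ?thesis
    using V_spaceI[of 0 P 0 "\<lambda>j. if j = i then 1 else 0"] by (intro A_ring_V) simp
qed

context exp_poly
begin

text \<open>
  \<open>P' exp P\<close> is a combination of the integrands of the first \<open>d\<close> primitives, which gives \<open>exp P - exp (P 0)\<close>.
  This element carries most of the separation: it vanishes at every infinite ramification point and at
  no point of the surface.
\<close>

lemma A_ring_exp: "(\<lambda>z. exp (poly P z)) \<in> A_ring P"
proof -
  have "{..degree (pderiv P)} = {..<degree P}"
    using degree_pos by (auto simp: degree_pderiv)
  then have e: "exp (poly P z) = exp (poly P 0) + (\<Sum>j<degree P. Polynomial.coeff (pderiv P) j * F_prim P j z)" for z
    using integration_by_parts[of 1 z] by simp
  show ?thesis
    using V_spaceI[of 0 P "exp (poly P 0)" "Polynomial.coeff (pderiv P)"]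
    by (intro A_ring_V) (simp only: poly_0 mult_zero_left mult_zero_right add_0_left e[symmetric])
qed

text \<open>
  Limits exist for the generators, and survive sums and products.
\<close>

lemma A_ring_convergent:
  assumes \<omega>: "ram_direction P \<omega>" and G: "G \<in> A_ring P"
  shows "\<exists>v. ((\<lambda>t. G (of_real t * \<omega>)) \<longlongrightarrow> v) at_top"
  using G unfolding A_ring_def
proof (induction rule: generate_ring.induct)
  case one
  then show ?case by (auto intro: tendsto_const)
next
  case (incl h)
  then obtain q c b where h: "h = (\<lambda>z. z * poly q z * exp (poly P z) + c + (\<Sum>j<degree P. b j * F_prim P j z))"
    unfolding V_space_def by blast
  have "((\<lambda>t. poly (pCons 0 q) (of_real t * \<omega>) * exp (poly P (of_real t * \<omega>)) + c
      + (\<Sum>j<degree P. b j * F_prim P j (of_real t * \<omega>))) \<longlongrightarrow> 0 + c + (\<Sum>j<degree P. b j * end_value j \<omega>)) at_top"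
    by (intro tendsto_intros poly_exp_tendsto_0 F_prim_tendsto_end_value \<omega>)
  then show ?case unfolding h by auto
next
  case (a_inv h)
  then have "\<ominus>\<^bsub>entire_ring\<^esub> h = (\<lambda>z. - h z)"
    by (intro a_inv_entire_ring A_ring_holomorphic) (simp add: A_ring_def)
  with a_inv.IH show ?case by (auto intro: tendsto_minus)
next
  case (eng_add h1 h2)
  then show ?case by (auto intro: tendsto_add)
next
  case (eng_mult h1 h2)
  then show ?case by (auto intro: tendsto_mult)
qed

end

context log_surface
begin

abbreviation R where "R \<equiv> structural_ring P k0 S"

definition lift :: "(complex \<Rightarrow> complex) \<Rightarrow> 's \<Rightarrow> complex" where
  "lift G = restrict (G \<circ> k0) S"

lemma lift_apply [simp]: "x \<in> S \<Longrightarrow> lift G x = G (k0 x)"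
  by (simp add: lift_def)

lemma carrier_R: "carrier R = lift ` A_ring P"
  by (auto simp: structural_ring_def lift_def)

lemma R_ops [simp]:
  "lift G \<otimes>\<^bsub>R\<^esub> lift H = lift (\<lambda>z. G z * H z)" "lift G \<oplus>\<^bsub>R\<^esub> lift H = lift (\<lambda>z. G z + H z)"
  "\<one>\<^bsub>R\<^esub> = lift (\<lambda>z. 1)" "\<zero>\<^bsub>R\<^esub> = lift (\<lambda>z. 0)"
  by (auto simp: structural_ring_def lift_def fun_eq_iff)

lemma ring_R: "ring R"
proof (rule ringI)
  show "abelian_group R"
  proof (rule abelian_groupI)
    fix f assume "f \<in> carrier R"
    then obtain G where "G \<in> A_ring P" "f = lift G" by (auto simp: carrier_R)
    then show "\<exists>g\<in>carrier R. g \<oplus>\<^bsub>R\<^esub> f = \<zero>\<^bsub>R\<^esub>"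
      by (intro bexI[of _ "lift (\<lambda>z. - G z)"]) (auto simp: carrier_R A_ring_uminus)
  qed (auto simp: carrier_R A_ring_add A_ring_const add_ac)
  show "monoid R"
    by (rule monoidI) (auto simp: carrier_R A_ring_mult A_ring_const mult_ac)
qed (auto simp: carrier_R algebra_simps)

lemma a_inv_R: "G \<in> A_ring P \<Longrightarrow> \<ominus>\<^bsub>R\<^esub> lift G = lift (\<lambda>z. - G z)"
  by (rule abelian_group.minus_equality[OF ring.is_abelian_group[OF ring_R]])
     (auto simp: carrier_R A_ring_uminus)

abbreviation val :: "(complex \<Rightarrow> complex) \<Rightarrow> 's \<Rightarrow> complex" where
  "val G w \<equiv> value_at P k0 S (lift G) w"

lemma val_in_S: "w \<in> S \<Longrightarrow> val G w = G (k0 w)"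
  by (simp add: value_at_def)

text \<open>
  The definite description in \<^const>\<open>value_at\<close> is well defined because only one ray ends at \<open>w\<close>.
\<close>

lemma val_end:
  assumes w: "w \<notin> S" and \<omega>: "ram_direction P \<omega>" "(ray k0 S \<omega> \<longlongrightarrow> w) at_top"
    and G: "((\<lambda>t. G (of_real t * \<omega>)) \<longlongrightarrow> v) at_top"
  shows "val G w = v"
proof -
  have lift_ray: "lift G (ray k0 S \<eta> t) = G (of_real t * \<eta>)" for \<eta> t by (simp add: ray_eq_pt)
  have "(THE v. \<exists>\<eta>. ram_direction P \<eta> \<and> (ray k0 S \<eta> \<longlongrightarrow> w) at_top \<and>
      ((\<lambda>t. lift G (ray k0 S \<eta> t)) \<longlongrightarrow> v) at_top) = v"
  proof (rule the_equality)
    show "\<exists>\<eta>. ram_direction P \<eta> \<and> (ray k0 S \<eta> \<longlongrightarrow> w) at_top \<and>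
      ((\<lambda>t. lift G (ray k0 S \<eta> t)) \<longlongrightarrow> v) at_top"
      unfolding lift_ray using \<omega> G by blast
  next
    fix v' assume "\<exists>\<eta>. ram_direction P \<eta> \<and> (ray k0 S \<eta> \<longlongrightarrow> w) at_top \<and>
      ((\<lambda>t. lift G (ray k0 S \<eta> t)) \<longlongrightarrow> v') at_top"
    then obtain \<eta> where \<eta>: "ram_direction P \<eta>" "(ray k0 S \<eta> \<longlongrightarrow> w) at_top"
      "((\<lambda>t. G (of_real t * \<eta>)) \<longlongrightarrow> v') at_top"
      unfolding lift_ray by blast
    have "\<eta> = \<omega>" by (rule ray_limit_unique[OF \<eta>(1,2) \<omega>])
    with \<eta>(3) G show "v' = v" using tendsto_unique[OF trivial_limit_at_top_linorder] by blast
  qed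
  then show ?thesis using w by (simp add: value_at_def)
qed

lemma val_hom:
  assumes w: "w \<in> Sstar"
  shows val_const: "val (\<lambda>z. c) w = c"
    and val_add: "\<lbrakk>G \<in> A_ring P; H \<in> A_ring P\<rbrakk> \<Longrightarrow> val (\<lambda>z. G z + H z) w = val G w + val H w"
    and val_mult: "\<lbrakk>G \<in> A_ring P; H \<in> A_ring P\<rbrakk> \<Longrightarrow> val (\<lambda>z. G z * H z) w = val G w * val H w"
proof -
  have "val (\<lambda>z. c) w = c \<and> (G \<in> A_ring P \<longrightarrow> H \<in> A_ring P \<longrightarrow>
      val (\<lambda>z. G z + H z) w = val G w + val H w \<and> val (\<lambda>z. G z * H z) w = val G w * val H w)" for G H
  proof (cases "w \<in> S")
    case False
    then obtain \<omega> where \<omega>: "ram_direction P \<omega>" "(ray k0 S \<omega> \<longlongrightarrow> w) at_top"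
      using ray_to_limit w by blast
    note at_end = val_end[OF False \<omega>]
    have "val (\<lambda>z. G z + H z) w = val G w + val H w \<and> val (\<lambda>z. G z * H z) w = val G w * val H w"
      if GH: "G \<in> A_ring P" "H \<in> A_ring P"
    proof -
      obtain u v where uv: "((\<lambda>t. G (of_real t * \<omega>)) \<longlongrightarrow> u) at_top" "((\<lambda>t. H (of_real t * \<omega>)) \<longlongrightarrow> v) at_top"
        using A_ring_convergent[OF \<omega>(1)] GH by blast
      then show ?thesis
        using at_end[OF uv(1)] at_end[OF uv(2)] at_end[OF tendsto_add[OF uv]] at_end[OF tendsto_mult[OF uv]]
        by simp
    qed
    then show ?thesis using at_end[OF tendsto_const] by blast
  qed (simp add: val_in_S)
  then show "val (\<lambda>z. c) w = c"
    "\<lbrakk>G \<in> A_ring P; H \<in> A_ring P\<rbrakk> \<Longrightarrow> val (\<lambda>z. G z + H z) w = val G w + val H w"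
    "\<lbrakk>G \<in> A_ring P; H \<in> A_ring P\<rbrakk> \<Longrightarrow> val (\<lambda>z. G z * H z) w = val G w * val H w"
    by blast+
qed

lemma point_ideal_eq: "point_ideal P k0 S w = lift ` {G \<in> A_ring P. val G w = 0}"
  by (auto simp: point_ideal_def carrier_R)

lemma ideal_point_ideal:
  assumes w: "w \<in> Sstar"
  shows "ideal (point_ideal P k0 S w) R"
proof (rule idealI[OF ring_R])
  have val_minus: "val (\<lambda>z. - G z) w = - val G w" if "G \<in> A_ring P" for G
    using val_mult[OF w A_ring_const[of "-1"] that] val_const[OF w] by simp
  show "subgroup (point_ideal P k0 S w) (add_monoid R)"
  proof
    fix x assume "x \<in> point_ideal P k0 S w"
    then obtain G where G: "x = lift G" "G \<in> A_ring P" "val G w = 0" by (auto simp: point_ideal_eq)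
    then have "\<ominus>\<^bsub>R\<^esub> x \<in> point_ideal P k0 S w"
      by (auto simp: a_inv_R point_ideal_eq val_minus A_ring_uminus)
    then show "inv\<^bsub>add_monoid R\<^esub> x \<in> point_ideal P k0 S w" by (simp add: a_inv_def)
  qed (auto simp: point_ideal_eq carrier_R A_ring_add A_ring_const val_add[OF w] val_const[OF w])
qed (auto simp: point_ideal_eq carrier_R A_ring_mult val_mult[OF w])

text \<open>
  The ideal is the kernel of a ring homomorphism onto \<open>the complex numbers\<close> that is split by the constants: an element of \<open>J\<close>
  with value \<open>v \<noteq> 0\<close> differs from the constant \<open>v\<close> by an element of the ideal, so \<open>J\<close> contains a unit.
\<close>

theorem maximalideal_point_ideal:
  assumes w: "w \<in> Sstar"
  shows "maximalideal (point_ideal P k0 S w) R"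
proof (rule maximalidealI[OF ideal_point_ideal[OF w]])
  have "value_at P k0 S \<one>\<^bsub>R\<^esub> w = 1" using val_const[OF w] by simp
  then have "\<one>\<^bsub>R\<^esub> \<notin> point_ideal P k0 S w" by (simp add: point_ideal_def)
  then show "carrier R \<noteq> point_ideal P k0 S w"
    using monoid.one_closed[OF ring.is_monoid[OF ring_R]] by blast
next
  fix J assume J: "ideal J R" "point_ideal P k0 S w \<subseteq> J" "J \<subseteq> carrier R"
  interpret J: ideal J R by (rule J(1))
  show "J = point_ideal P k0 S w \<or> J = carrier R"
  proof (rule disjCI)
    assume "J \<noteq> carrier R"
    show "J = point_ideal P k0 S w"
    proof (rule ccontr)
      assume "J \<noteq> point_ideal P k0 S w"
      then obtain G where G: "lift G \<in> J" "G \<in> A_ring P" "lift G \<notin> point_ideal P k0 S w"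
        using J by (auto simp: carrier_R)
      define v where "v = val G w"
      have v: "v \<noteq> 0" using G by (auto simp: v_def point_ideal_def carrier_R)
      let ?H = "\<lambda>z. v + (- 1) * G z"
      have m1: "(\<lambda>z. (- 1) * G z) \<in> A_ring P" by (intro A_ring_mult A_ring_const G)
      have "val ?H w = v + (- 1) * v"
        using val_add[OF w A_ring_const m1] val_mult[OF w A_ring_const G(2)] val_const[OF w]
        by (simp only: v_def)
      then have "lift ?H \<in> J"
        using J(2) A_ring_add[OF A_ring_const m1] by (auto simp: point_ideal_eq)
      then have "lift ?H \<oplus>\<^bsub>R\<^esub> lift G \<in> J" using G(1)
        by (rule additive_subgroup.a_closed[OF J.is_additive_subgroup])
      then have "lift (\<lambda>z. v) \<in> J" by simp
      moreover have "lift (\<lambda>z. 1 / v) \<in> carrier R" by (simp add: carrier_R A_ring_const)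
      ultimately have "lift (\<lambda>z. 1 / v) \<otimes>\<^bsub>R\<^esub> lift (\<lambda>z. v) \<in> J" by (rule J.I_l_closed)
      then have "\<one>\<^bsub>R\<^esub> \<in> J" using v by simp
      then show False using J.one_imp_carrier \<open>J \<noteq> carrier R\<close> by simp
    qed
  qed
qed

lemma separates_S_from_ends:
  assumes "w \<in> S" "w' \<in> Sstar" "w' \<notin> S"
  shows "\<exists>G\<in>A_ring P. val G w \<noteq> val G w'"
proof
  obtain \<omega> where \<omega>: "ram_direction P \<omega>" "(ray k0 S \<omega> \<longlongrightarrow> w') at_top"
    using ray_to_limit assms by blast
  have "val (\<lambda>z. exp (poly P z)) w' = 0"
    using poly_exp_tendsto_0[OF \<omega>(1), of 1] by (intro val_end[OF assms(3) \<omega>]) simp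
  then show "val (\<lambda>z. exp (poly P z)) w \<noteq> val (\<lambda>z. exp (poly P z)) w'"
    using assms(1) by (simp add: val_in_S)
qed (rule A_ring_exp)

theorem separates_points:
  assumes w: "w \<in> Sstar" "w' \<in> Sstar" "w \<noteq> w'"
  shows "\<exists>G\<in>A_ring P. val G w \<noteq> val G w'"
proof -
  consider "w \<in> S" "w' \<in> S" | "w \<in> S" "w' \<notin> S" | "w \<notin> S" "w' \<in> S" | "w \<notin> S" "w' \<notin> S"
    by blast
  then show ?thesis
  proof cases
    case 1
    show ?thesis
    proof (rule ccontr)
      assume "\<not> ?thesis"
      then have eq: "G (k0 w) = G (k0 w')" if "G \<in> A_ring P" for G
        using that 1 by (auto simp: val_in_S)
      have "k0 w ^ Suc 0 * exp (poly P (k0 w)) = k0 w' ^ Suc 0 * exp (poly P (k0 w'))"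
        and "exp (poly P (k0 w)) = exp (poly P (k0 w'))"
        using eq[OF A_ring_monomial_exp[of 0]] eq[OF A_ring_exp] by auto
      then have "k0 w = k0 w'" by simp
      then show False using 1 w(3) by (metis pt_k0)
    qed
  next
    case 4
    obtain \<omega> where \<omega>: "ram_direction P \<omega>" "(ray k0 S \<omega> \<longlongrightarrow> w) at_top"
      using ray_to_limit w 4 by blast
    obtain \<omega>' where \<omega>': "ram_direction P \<omega>'" "(ray k0 S \<omega>' \<longlongrightarrow> w') at_top"
      using ray_to_limit w 4 by blast
    have "\<omega> \<noteq> \<omega>'"
      using \<omega>(2) \<omega>'(2) w(3) tendsto_unique[OF trivial_limit_at_top_linorder] by blast
    then obtain j where j: "j < degree P" "end_value j \<omega> \<noteq> end_value j \<omega>'"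
      using end_values_separate[OF \<omega>(1) \<omega>'(1)] by blast
    have "val (F_prim P j) w = end_value j \<omega>" "val (F_prim P j) w' = end_value j \<omega>'"
      using val_end[OF 4(1) \<omega> F_prim_tendsto_end_value[OF \<omega>(1)]]
        val_end[OF 4(2) \<omega>' F_prim_tendsto_end_value[OF \<omega>'(1)]] by auto
    with j A_ring_F_prim[OF j(1)] show ?thesis by metis
  next
    case 2
    then show ?thesis using separates_S_from_ends w by blast
  next
    case 3
    then show ?thesis using separates_S_from_ends[of w' w] w by metis
  qed
qed

theorem inj_on_point_ideal: "inj_on (point_ideal P k0 S) Sstar"
proof (rule inj_onI, rule ccontr)
  fix w w' assume w: "w \<in> Sstar" "w' \<in> Sstar" and eq: "point_ideal P k0 S w = point_ideal P k0 S w'" and "w \<noteq> w'"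
  then obtain G where G: "G \<in> A_ring P" "val G w \<noteq> val G w'" using separates_points by blast
  let ?H = "\<lambda>z. - val G w + G z"
  have H: "?H \<in> A_ring P" by (intro A_ring_add A_ring_const G)
  have val_H: "val ?H x = - val G w + val G x" if "x \<in> Sstar" for x
    by (simp only: val_add[OF that A_ring_const G(1)] val_const[OF that])
  have "lift ?H \<in> point_ideal P k0 S w"
    using H val_H[OF w(1)] by (simp add: point_ideal_def carrier_R)
  moreover have "lift ?H \<notin> point_ideal P k0 S w'"
    using G(2) val_H[OF w(2)] by (simp add: point_ideal_def)
  ultimately show False using eq by simp
qed

end

theorem mainTheorem12:
  fixes P0 :: "complex poly"
    and k0 :: "'s::metric_space \<Rightarrow> complex"
    and S Sstar :: "'s set"
  assumes "degree P0 \<ge> 1"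
    and "completed_log_surface P0 k0 S Sstar"
  shows "(\<forall>w\<in>Sstar. maximalideal (point_ideal P0 k0 S w) (structural_ring P0 k0 S))
    \<and> inj_on (point_ideal P0 k0 S) Sstar
    \<and> (\<forall>w\<in>Sstar. \<forall>w'\<in>Sstar. w \<noteq> w' \<longrightarrow>
          (\<exists>f\<in>carrier (structural_ring P0 k0 S).
              value_at P0 k0 S f w \<noteq> value_at P0 k0 S f w'))"
proof -
  interpret log_surface P0 k0 S Sstar
    by unfold_locales (use assms in auto)
  have "\<exists>f\<in>carrier R. value_at P0 k0 S f w \<noteq> value_at P0 k0 S f w'"
    if "w \<in> Sstar" "w' \<in> Sstar" "w \<noteq> w'" for w w'
    using separates_points[OF that] by (auto simp: carrier_R)
  then show ?thesis
    using maximalideal_point_ideal inj_on_point_ideal by blast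
qed

end
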